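(* Let $P$ be an infinite field and $P[X]=P[x_1,\ldots,x_n]$ the free commutative (polynomial) algebra over $P$ on a finite set $X$. Then every automorphism of the semigroup $\mathrm{End}(P[X])$ is semiinner: for every automorphism $\tau$ of $\mathrm{End}(P[X])$ there exist a field automorphism $\alpha\in\mathrm{Aut}(P)$ and an algebra automorphism $\eta\in\mathrm{Aut}(P[X])$ such that, with $\mu=\overline{\alpha}\,\eta$, one has $\tau(s)=\mu s\mu^{-1}$ for all $s\in\mathrm{End}(P[X])$.
   Context: $\mathrm{End}(P[X])$ is the semigroup (under composition) of all $P$-algebra endomorphisms of $P[X]$. For $\alpha\in\mathrm{Aut}(P)$, $\overline{\alpha}:P[X]\to P[X]$ is the bijection acting on coefficients: $\overline{\alpha}(\sum_k a_k u_k)=\sum_k\alpha(a_k)u_k$ for monomials $u_k$ and $a_k\in P$. An automorphism $\tau$ of $\mathrm{End}(P[X])$ is called semiinner if $\tau(s)=\mu s\mu^{-1}$ for all $s$, where $\mu=\overline{\alpha}\eta$ with $\alpha\in\mathrm{Aut}(P)$, $\eta\in\mathrm{Aut}(P[X])$. *)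

theory Defs
  imports "HOL-Library.Poly_Mapping"
begin

text \<open>Polynomial algebra P[X] over a field P on a finite set X of variables
 (X is the finite type 'v): finitely supported maps from monomials
 (exponent vectors) to coefficients.\<close>
type_synonym ('v, 'a) mpoly = "('v \<Rightarrow>\<^sub>0 nat) \<Rightarrow>\<^sub>0 'a"

definition pconst :: "'a::zero \<Rightarrow> ('v, 'a) mpoly" where
  "pconst c = Poly_Mapping.single 0 c"

definition is_alg_endo :: "(('v, 'a::field) mpoly \<Rightarrow> ('v, 'a) mpoly) \<Rightarrow> bool" where
  "is_alg_endo f \<longleftrightarrow>
     (\<forall>p q. f (p + q) = f p + f q) \<and>
     (\<forall>p q. f (p * q) = f p * f q) \<and>
     f 1 = 1 \<and>
     (\<forall>c p. f (pconst c * p) = pconst c * f p)"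

definition End_alg :: "(('v, 'a::field) mpoly \<Rightarrow> ('v, 'a) mpoly) set" where
  "End_alg = {f. is_alg_endo f}"

definition is_alg_aut :: "(('v, 'a::field) mpoly \<Rightarrow> ('v, 'a) mpoly) \<Rightarrow> bool" where
  "is_alg_aut f \<longleftrightarrow> is_alg_endo f \<and> bij f"

definition is_field_aut :: "('a::field \<Rightarrow> 'a) \<Rightarrow> bool" where
  "is_field_aut \<alpha> \<longleftrightarrow> bij \<alpha> \<and> (\<forall>x y. \<alpha> (x + y) = \<alpha> x + \<alpha> y) \<and>
     (\<forall>x y. \<alpha> (x * y) = \<alpha> x * \<alpha> y) \<and> \<alpha> 1 = 1"

definition coeff_map :: "('a::zero \<Rightarrow> 'a) \<Rightarrow> ('v, 'a) mpoly \<Rightarrow> ('v, 'a) mpoly" where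
  "coeff_map \<alpha> p = Poly_Mapping.map \<alpha> p"

definition is_semigroup_aut_End ::
  "((('v, 'a::field) mpoly \<Rightarrow> ('v, 'a) mpoly) \<Rightarrow> (('v, 'a) mpoly \<Rightarrow> ('v, 'a) mpoly)) \<Rightarrow> bool" where
  "is_semigroup_aut_End \<tau> \<longleftrightarrow> bij_betw \<tau> End_alg End_alg \<and>
     (\<forall>s\<in>End_alg. \<forall>t\<in>End_alg. \<tau> (s \<circ> t) = \<tau> s \<circ> \<tau> t)"

end

theory Submission
  imports Defs "HOL-Computational_Algebra.Polynomial"
begin

text \<open>
  Evaluation at a point \<open>a \<in> P\<^sup>n\<close>, followed by the inclusion of constants, is an endomorphism, and
  these endomorphisms are exactly the right zeros of the semigroup. Hence \<open>\<tau>\<close> permutes them, which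
  gives a bijection \<open>\<sigma>\<close> of \<open>P\<^sup>n\<close> such that \<open>c \<mapsto> \<sigma> \<circ> c \<circ> \<sigma>\<^sup>-\<^sup>1\<close> permutes the polynomial maps; it
  remains to show that \<open>\<sigma>\<close> is a polynomial automorphism up to a field automorphism of \<open>P\<close>.

  Let \<open>R\<close> and \<open>C\<close> consist of the functions \<open>b \<circ> \<sigma>\<close> and \<open>b \<circ> \<sigma>\<^sup>-\<^sup>1\<close> with \<open>b\<close> polynomial. Both are algebras
  of functions closed under precomposition with polynomial maps, and substituting elements of \<open>C\<close>
  into an element of \<open>R\<close>, or conversely, yields a polynomial function. It suffices to find a field
  automorphism \<open>\<alpha>\<close> which, as a function of one coordinate, lies in \<open>R\<close> while its inverse lies in \<open>C\<close>.
  For \<open>n = 1\<close> an affine modification of \<open>\<sigma>\<close> is such an \<open>\<alpha>\<close>, because the invertible polynomials are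
  the affine ones.

  Let \<open>n \<ge> 2\<close>. Differentiating the identity \<open>\<sigma> \<circ> \<sigma>\<^sup>-\<^sup>1\<close> gives univariate \<open>r \<in> R\<close>, \<open>g \<in> C\<close> with \<open>g(0) = 0\<close>
  and \<open>(r \<circ> g)'(0) \<noteq> 0\<close>. The function \<open>u(a) = (r \<circ> a g)'(0)\<close> is additive by the chain rule in two
  variables, and since \<open>g \<circ> (r - r(0))\<close> is a polynomial with some linear coefficient \<open>\<kappa>\<close>, it satisfies
  \<open>u(a) u(b) = u(\<kappa> a b)\<close>; so \<open>u(a) = \<alpha>(\<kappa> a)\<close> for a field homomorphism \<open>\<alpha>\<close>. Then \<open>\<alpha> \<circ> g\<close> is a
  polynomial, and interpolation with scalars from \<open>\<alpha>(P)\<close> splits \<open>g\<close> into elements \<open>\<gamma>\<close> of \<open>C\<close> for which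
  \<open>\<alpha> \<circ> \<gamma>\<close> is a monomial. Repeating the construction of \<open>\<alpha>\<close> with such a \<open>\<gamma>\<close> in place of \<open>g\<close> and
  rescaling the argument of \<open>\<gamma>\<close> shows that the new homomorphism inverts a multiple of \<open>\<gamma>\<close>. So it
  is an automorphism with inverse in \<open>C\<close>; by interpolation it lies in \<open>R\<close>.
\<close>

section \<open>Polynomial functions and maps\<close>

text \<open>Functions rather than formal polynomials, since the bijection \<sigma> acts on points.
  \<open>polyfun_imp_mpoly_eval\<close> and, over an infinite domain, \<open>mpoly_eqI\<close> lead
  back to formal polynomials.\<close>

inductive_set polyfun :: "(('v \<Rightarrow> 'a::comm_ring_1) \<Rightarrow> 'a) set" where
  const: "(\<lambda>_. c) \<in> polyfun"
| var: "(\<lambda>x. x v) \<in> polyfun"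
| add: "f \<in> polyfun \<Longrightarrow> g \<in> polyfun \<Longrightarrow> (\<lambda>x. f x + g x) \<in> polyfun"
| mult: "f \<in> polyfun \<Longrightarrow> g \<in> polyfun \<Longrightarrow> (\<lambda>x. f x * g x) \<in> polyfun"

definition polymap :: "(('v \<Rightarrow> 'a::comm_ring_1) \<Rightarrow> 'w \<Rightarrow> 'a) set" where
  "polymap = {f. \<forall>w. (\<lambda>x. f x w) \<in> polyfun}"

lemma polymapD: "f \<in> polymap \<Longrightarrow> (\<lambda>x. f x w) \<in> polyfun"
  by (simp add: polymap_def)

lemma polyfun_comp:
  assumes "f \<in> polyfun" "c \<in> polymap"
  shows "(\<lambda>x. f (c x)) \<in> polyfun"
  using assms(1)
  by induction (use assms(2) in \<open>auto intro: polyfun.intros polymapD\<close>)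

lemma polyfun_sum: "(\<And>k. k \<in> A \<Longrightarrow> f k \<in> polyfun) \<Longrightarrow> (\<lambda>x. \<Sum>k\<in>A. f k x) \<in> polyfun"
  by (induction A rule: infinite_finite_induct) (auto intro: polyfun.intros)

lemma polyfun_if: "f \<in> polyfun \<Longrightarrow> g \<in> polyfun \<Longrightarrow> (\<lambda>x. if P then f x else g x) \<in> polyfun"
  by (cases P) auto

lemma polyfun_power: "f \<in> polyfun \<Longrightarrow> (\<lambda>x. f x ^ n) \<in> polyfun"
  by (induction n) (auto intro: polyfun.intros)

lemma polyfun_prod: "(\<And>k. k \<in> A \<Longrightarrow> f k \<in> polyfun) \<Longrightarrow> (\<lambda>x. \<Prod>k\<in>A. f k x) \<in> polyfun"
  by (induction A rule: infinite_finite_induct) (auto intro: polyfun.intros)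

lemma polyfun_poly: "f \<in> polyfun \<Longrightarrow> (\<lambda>x. poly q (f x)) \<in> polyfun"
  by (induction q) (auto intro!: polyfun.intros)

section \<open>Taylor expansion along lines\<close>

text \<open>Induction on the generation of \<open>f\<close>, with \<open>D w\<close> the partial
  derivative in direction \<open>w\<close>. The remainder \<open>q\<close> may depend on
  \<open>x\<close> and \<open>y\<close>, whereas \<open>D\<close> is chosen once and is polynomial
  in the base point.\<close>

lemma polyfun_taylor:
  fixes f :: "('v::finite \<Rightarrow> 'a::comm_ring_1) \<Rightarrow> 'a"
  assumes "f \<in> polyfun"
  shows "\<exists>D. (\<forall>w. D w \<in> polyfun) \<and> (\<forall>x y. \<exists>q. \<forall>t.
           f (\<lambda>w. x w + t * y w) = poly (pCons (f x) (pCons (\<Sum>w\<in>UNIV. D w x * y w) q)) t)"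
  using assms
proof induction
  case (const c)
  show ?case
    by (rule exI[of _ "\<lambda>_ _. 0"]) (auto intro!: polyfun.const exI[of _ 0])
next
  case (var v)
  have "(\<Sum>w\<in>UNIV. (if w = v then 1 else 0) * y w) = y v" for y :: "'v \<Rightarrow> 'a"
    by (simp add: if_distrib[of "\<lambda>c. c * _"] cong: if_cong)
  then show ?case
    by (intro exI[of _ "\<lambda>w _. if w = v then 1 else 0"])
       (auto intro!: polyfun.const exI[of _ 0])
next
  case (add f g)
  then obtain D E where
    D: "\<And>w. D w \<in> polyfun"
      "\<And>x y. \<exists>q. \<forall>t. f (\<lambda>w. x w + t * y w) = poly (pCons (f x) (pCons (\<Sum>w\<in>UNIV. D w x * y w) q)) t"
    and E: "\<And>w. E w \<in> polyfun"
      "\<And>x y. \<exists>q. \<forall>t. g (\<lambda>w. x w + t * y w) = poly (pCons (g x) (pCons (\<Sum>w\<in>UNIV. E w x * y w) q)) t"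
    by blast
  have "\<exists>q. \<forall>t. f (\<lambda>w. x w + t * y w) + g (\<lambda>w. x w + t * y w)
      = poly (pCons (f x + g x) (pCons (\<Sum>w\<in>UNIV. (D w x + E w x) * y w) q)) t" for x y
  proof -
    obtain q where "\<forall>t. f (\<lambda>w. x w + t * y w) = poly (pCons (f x) (pCons (\<Sum>w\<in>UNIV. D w x * y w) q)) t"
      using D(2) by blast
    moreover obtain q' where "\<forall>t. g (\<lambda>w. x w + t * y w) = poly (pCons (g x) (pCons (\<Sum>w\<in>UNIV. E w x * y w) q')) t"
      using E(2) by blast
    ultimately show ?thesis
      by (intro exI[of _ "q + q'"]) (simp add: sum.distrib algebra_simps)
  qed
  with D(1) E(1) show ?case
    by (intro exI[of _ "\<lambda>w x. D w x + E w x"]) (auto intro: polyfun.add)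
next
  case (mult f g)
  then obtain D E where
    D: "\<And>w. D w \<in> polyfun"
      "\<And>x y. \<exists>q. \<forall>t. f (\<lambda>w. x w + t * y w) = poly (pCons (f x) (pCons (\<Sum>w\<in>UNIV. D w x * y w) q)) t"
    and E: "\<And>w. E w \<in> polyfun"
      "\<And>x y. \<exists>q. \<forall>t. g (\<lambda>w. x w + t * y w) = poly (pCons (g x) (pCons (\<Sum>w\<in>UNIV. E w x * y w) q)) t"
    by blast
  have "\<exists>q. \<forall>t. f (\<lambda>w. x w + t * y w) * g (\<lambda>w. x w + t * y w)
      = poly (pCons (f x * g x) (pCons (\<Sum>w\<in>UNIV. (D w x * g x + f x * E w x) * y w) q)) t" for x y
  proof -
    define b where "b = (\<Sum>w\<in>UNIV. D w x * y w)"
    define c where "c = (\<Sum>w\<in>UNIV. E w x * y w)"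
    obtain q where q: "\<forall>t. f (\<lambda>w. x w + t * y w) = poly (pCons (f x) (pCons b q)) t"
      using D(2) unfolding b_def by blast
    obtain q' where q': "\<forall>t. g (\<lambda>w. x w + t * y w) = poly (pCons (g x) (pCons c q')) t"
      using E(2) unfolding c_def by blast
    have s: "(\<Sum>w\<in>UNIV. (D w x * g x + f x * E w x) * y w) = b * g x + f x * c"
      unfolding b_def c_def by (simp add: sum.distrib sum_distrib_left sum_distrib_right algebra_simps)
    \<comment> \<open>The witness is what remains of the product of both expansions after removing
      the constant and linear terms and dividing by \<open>t ^ 2\<close>.\<close>
    show ?thesis
      unfolding s
      by (intro exI[of _ "smult (f x) q' + smult (g x) q + [:b * c:]
            + [:0, 1:] * (smult b q' + smult c q) + [:0, 0, 1:] * (q * q')"])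
         (simp add: q q' algebra_simps)
  qed
  with D E mult.hyps show ?case
    by (intro exI[of _ "\<lambda>w x. D w x * g x + f x * E w x"]) (auto intro!: polyfun.add polyfun.mult)
qed

lemma polyfun_line:
  fixes f :: "('v::finite \<Rightarrow> 'a::comm_ring_1) \<Rightarrow> 'a"
  assumes "f \<in> polyfun"
  shows "\<exists>q. \<forall>t. f (\<lambda>w. x w + t * y w) = poly q t"
  using polyfun_taylor[OF assms] by meson

lemma polyfun_univariate:
  fixes h :: "'a::comm_ring_1 \<Rightarrow> 'a" and i :: "'v::finite"
  assumes "(\<lambda>x. h (x i)) \<in> polyfun"
  shows "\<exists>q. h = poly q"
  using polyfun_line[OF assms, of "\<lambda>_. 0" "\<lambda>_. 1"] by (auto simp: fun_eq_iff)

section \<open>Linear coefficients of polynomial functions\<close>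

lemma poly_eqI_infinite:
  fixes p q :: "'a::idom poly"
  assumes "infinite (UNIV :: 'a set)" "\<And>t. poly p t = poly q t"
  shows "p = q"
  using poly_roots_finite[of "p - q"] assms by auto

text \<open>Only meaningful for polynomial functions over an infinite domain.\<close>

definition lin_coeff :: "('a::comm_ring_1 \<Rightarrow> 'a) \<Rightarrow> 'a" where
  "lin_coeff f = coeff (THE q. f = poly q) 1"

lemma lin_coeff_poly:
  fixes q :: "'a::idom poly"
  assumes "infinite (UNIV :: 'a set)"
  shows "lin_coeff (poly q) = coeff q 1"
proof -
  have "(THE p. poly q = poly p) = q"
    using poly_eqI_infinite[OF assms] by (intro the_equality) (auto simp: fun_eq_iff)
  then show ?thesis by (simp add: lin_coeff_def)
qed

lemma lin_coeff_eqI: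
  fixes q :: "'a::idom poly"
  assumes "infinite (UNIV :: 'a set)" "\<And>t. f t = poly q t"
  shows "lin_coeff f = coeff q 1"
  using lin_coeff_poly[OF assms(1), of q] assms(2) by (metis ext)

lemma lin_coeff_const:
  assumes "infinite (UNIV :: 'a::idom set)"
  shows "lin_coeff (\<lambda>_. c :: 'a) = 0"
  using lin_coeff_eqI[OF assms, of "\<lambda>_. c" "[:c:]"] by simp

text \<open>This provides a chain rule for composites that are polynomial although their factors
  need not be: derivatives are linear in the direction and polynomial in the base point.\<close>

lemma polyfun_lin_coeff:
  fixes f :: "('v::finite \<Rightarrow> 'a::idom) \<Rightarrow> 'a"
  assumes "infinite (UNIV :: 'a set)" "f \<in> polyfun"
  obtains D where "\<And>w. D w \<in> polyfun"
    "\<And>x y. lin_coeff (\<lambda>t. f (\<lambda>w. x w + t * y w)) = (\<Sum>w\<in>UNIV. D w x * y w)"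
proof -
  obtain D where D: "\<And>w. D w \<in> polyfun"
    "\<And>x y. \<exists>q. \<forall>t. f (\<lambda>w. x w + t * y w) = poly (pCons (f x) (pCons (\<Sum>w\<in>UNIV. D w x * y w) q)) t"
    using polyfun_taylor[OF assms(2)] by blast
  have "lin_coeff (\<lambda>t. f (\<lambda>w. x w + t * y w)) = (\<Sum>w\<in>UNIV. D w x * y w)" for x y
  proof -
    obtain q where q: "\<And>t. f (\<lambda>w. x w + t * y w) = poly (pCons (f x) (pCons (\<Sum>w\<in>UNIV. D w x * y w) q)) t"
      using D(2) by blast
    show ?thesis
      using lin_coeff_eqI[OF assms(1) q] by simp
  qed
  with D(1) show thesis using that by blast
qed

text \<open>Chain rule at the origin; \<open>poly q 0 = 0\<close> makes the outer derivative be
  taken at 0 as well.\<close>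

lemma lin_coeff_comp:
  fixes p q :: "'a::idom poly"
  assumes inf: "infinite (UNIV :: 'a set)" and "poly q 0 = 0"
  shows "lin_coeff (\<lambda>t. poly p (poly q t)) = lin_coeff (poly p) * lin_coeff (poly q)"
proof -
  obtain q' where q: "q = pCons 0 q'"
    using assms(2) by (cases q) auto
  have "lin_coeff (\<lambda>t. poly p (poly q t)) = coeff (pcompose p q) 1"
    by (rule lin_coeff_eqI[OF inf]) (simp add: poly_pcompose)
  also have "\<dots> = coeff p 1 * coeff q 1"
  proof (cases p)
    case (pCons a p')
    show ?thesis
      by (cases p') (simp add: pCons pcompose_pCons q coeff_mult coeff_pCons pcompose_pCons)
  qed
  finally show ?thesis by (simp add: lin_coeff_poly[OF inf])
qed

section \<open>Extraction of coefficients by interpolation\<close>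

text \<open>Lagrange interpolation at \<open>N + 1\<close> nodes: \<open>a b\<close> is the
  coefficient of index \<open>k\<close> of the basis polynomial of the node \<open>b\<close>, and
  \<open>t ^ j\<close> with \<open>j \<le> N\<close> is its own interpolant.\<close>

lemma coeff_extraction:
  assumes "infinite (UNIV :: 'a::field set)"
  obtains B :: "'a::field set" and a :: "'a::field \<Rightarrow> 'a" where "finite B"
    "\<And>j. j \<le> N \<Longrightarrow> (\<Sum>b\<in>B. a b * b ^ j) = (if j = k then 1 else 0)"
proof -
  obtain B :: "'a set" where B: "finite B" "card B = Suc N"
    using infinite_arbitrarily_large[OF assms] by blast
  define l where "l = (\<lambda>b. \<Prod>c\<in>B - {b}. smult (1 / (b - c)) [:-c, 1:])"
  have poly_l: "poly (l b) b' = (if b' = b then 1 else 0)" if "b \<in> B" "b' \<in> B" for b b'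
  proof (cases "b' = b")
    case True
    then show ?thesis
      unfolding l_def poly_prod by (auto intro!: prod.neutral simp: diff_divide_distrib[symmetric] split: if_splits)
  next
    case False
    then have "\<exists>c\<in>B - {b}. poly (smult (1 / (b - c)) [:-c, 1:]) b' = 0"
      using that by (intro bexI[of _ b']) auto
    then show ?thesis
      using False B(1) unfolding l_def poly_prod by (simp add: prod_zero)
  qed
  have deg_l: "Polynomial.degree (l b) \<le> N" if "b \<in> B" for b
  proof -
    have "Polynomial.degree (l b)
        \<le> sum (Polynomial.degree \<circ> (\<lambda>c. smult (1 / (b - c)) [:-c, 1:])) (B - {b})"
      unfolding l_def by (rule degree_prod_sum_le[OF finite_Diff[OF B(1)]])
    also have "\<dots> \<le> (\<Sum>c\<in>B - {b}. 1)"
    proof (rule sum_mono)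
      show "(Polynomial.degree \<circ> (\<lambda>c. smult (1 / (b - c)) [:-c, 1:])) c \<le> 1" for c
        unfolding o_def by (rule order_trans[OF degree_smult_le]) simp
    qed
    also have "\<dots> = N" using that B by simp
    finally show ?thesis .
  qed
  have "(\<Sum>b\<in>B. coeff (l b) k * b ^ j) = (if j = k then 1 else 0)" if "j \<le> N" for j
  proof -
    define H where "H = (\<Sum>b\<in>B. smult (b ^ j) (l b))"
    have "monom 1 j = H"
    proof (rule poly_eqI_degree[of B])
      fix x assume "x \<in> B"
      then have "poly H x = (\<Sum>b\<in>B. b ^ j * (if x = b then 1 else 0))"
        unfolding H_def poly_sum by (intro sum.cong) (auto simp: poly_l)
      also have "\<dots> = x ^ j"
        using \<open>x \<in> B\<close> B(1) by (simp add: if_distrib[of "\<lambda>c. _ * c"] cong: if_cong)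
      finally show "poly (monom 1 j) x = poly H x" by (simp add: poly_monom)
    next
      show "Polynomial.degree (monom 1 j :: 'a poly) < card B" "Polynomial.degree H < card B"
        using that B deg_l unfolding H_def
        by (auto simp: degree_monom_eq less_Suc_eq_le
             intro!: degree_sum_le order_trans[OF degree_smult_le])
    qed
    then have "coeff (monom 1 j) k = coeff H k" by simp
    then show ?thesis
      unfolding H_def by (simp add: coeff_sum mult.commute)
  qed
  then show thesis by (rule that[OF B(1)])
qed

section \<open>Bijections normalizing the polynomial maps\<close>

text \<open>
  For a bijection \<open>\<sigma>\<close> with inverse \<open>\<rho>\<close>, the algebras \<open>R\<close> and \<open>C\<close> of the introduction are
  \<open>regular \<rho>\<close> and \<open>regular \<sigma>\<close>.
\<close>

definition regular :: "(('v \<Rightarrow> 'a) \<Rightarrow> ('v \<Rightarrow> 'a)) \<Rightarrow> (('v \<Rightarrow> 'a::comm_ring_1) \<Rightarrow> 'a) set" where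
  "regular \<theta> = {r. (\<lambda>y. r (\<theta> y)) \<in> polyfun}"

text \<open>For the bijections considered below, a single coordinate decides membership
  (\<open>regular1I\<close>).\<close>

definition regular1 :: "(('v \<Rightarrow> 'a) \<Rightarrow> ('v \<Rightarrow> 'a)) \<Rightarrow> ('a::comm_ring_1 \<Rightarrow> 'a) set" where
  "regular1 \<theta> = {r. \<forall>v. (\<lambda>x. r (x v)) \<in> regular \<theta>}"

lemma regular_const: "(\<lambda>_. c) \<in> regular \<theta>"
  and regular_add: "r \<in> regular \<theta> \<Longrightarrow> s \<in> regular \<theta> \<Longrightarrow> (\<lambda>x. r x + s x) \<in> regular \<theta>"
  and regular_mult: "r \<in> regular \<theta> \<Longrightarrow> s \<in> regular \<theta> \<Longrightarrow> (\<lambda>x. r x * s x) \<in> regular \<theta>"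
  by (auto simp: regular_def intro: polyfun.intros)

lemma regular1D: "r \<in> regular1 \<theta> \<Longrightarrow> (\<lambda>x. r (x v)) \<in> regular \<theta>"
  by (simp add: regular1_def)

lemma regular1_const: "(\<lambda>_. c) \<in> regular1 \<theta>"
  and regular1_add: "r \<in> regular1 \<theta> \<Longrightarrow> s \<in> regular1 \<theta> \<Longrightarrow> (\<lambda>x. r x + s x) \<in> regular1 \<theta>"
  and regular1_mult: "r \<in> regular1 \<theta> \<Longrightarrow> s \<in> regular1 \<theta> \<Longrightarrow> (\<lambda>x. r x * s x) \<in> regular1 \<theta>"
  by (auto simp: regular1_def regular_const regular_add regular_mult)

lemma regular1_sum: "(\<And>k. k \<in> A \<Longrightarrow> f k \<in> regular1 \<theta>) \<Longrightarrow> (\<lambda>x. \<Sum>k\<in>A. f k x) \<in> regular1 \<theta>"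
  by (induction A rule: infinite_finite_induct) (auto intro: regular1_const regular1_add)

lemma regular1_poly: "r \<in> regular1 \<theta> \<Longrightarrow> (\<lambda>s. poly q (r s)) \<in> regular1 \<theta>"
  by (induction q) (auto intro!: regular1_const regular1_add regular1_mult)

section \<open>Homomorphisms of the ground field\<close>

definition field_hom :: "('a::field \<Rightarrow> 'a) \<Rightarrow> bool" where
  "field_hom \<alpha> \<longleftrightarrow> (\<forall>x y. \<alpha> (x + y) = \<alpha> x + \<alpha> y) \<and> (\<forall>x y. \<alpha> (x * y) = \<alpha> x * \<alpha> y) \<and> \<alpha> 1 = 1"

context
  fixes \<alpha> :: "'a::field \<Rightarrow> 'a"
  assumes \<alpha>: "field_hom \<alpha>"
begin

lemma field_hom_add: "\<alpha> (x + y) = \<alpha> x + \<alpha> y"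
  and field_hom_mult: "\<alpha> (x * y) = \<alpha> x * \<alpha> y"
  and field_hom_1: "\<alpha> 1 = 1"
  using \<alpha> by (auto simp: field_hom_def)

lemma field_hom_0: "\<alpha> 0 = 0"
  using field_hom_add[of 0 0] by (metis add.right_neutral add_left_cancel)

lemma field_hom_minus: "\<alpha> (- x) = - \<alpha> x"
  using field_hom_add[of x "- x"] field_hom_0 by (simp add: add_eq_0_iff)

lemma field_hom_eq_0_iff: "\<alpha> x = 0 \<longleftrightarrow> x = 0"
proof (cases "x = 0")
  case False
  then have "\<alpha> x * \<alpha> (inverse x) = 1"
    using field_hom_mult[of x "inverse x"] field_hom_1 by simp
  with False show ?thesis by auto
qed (simp add: field_hom_0)

lemma field_hom_inj: "inj \<alpha>"
proof (rule injI)
  fix x y assume "\<alpha> x = \<alpha> y"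
  then have "\<alpha> (x - y) = 0"
    using field_hom_add[of x "- y"] by (simp add: field_hom_minus)
  then show "x = y" by (simp add: field_hom_eq_0_iff)
qed

lemma field_hom_sum: "\<alpha> (\<Sum>k\<in>A. f k) = (\<Sum>k\<in>A. \<alpha> (f k))"
  by (induction A rule: infinite_finite_induct) (auto simp: field_hom_0 field_hom_add)

lemma field_hom_power: "\<alpha> (x ^ n) = \<alpha> x ^ n"
  by (induction n) (auto simp: field_hom_1 field_hom_mult)

lemma field_hom_divide: "\<alpha> (x / y) = \<alpha> x / \<alpha> y"
proof (cases "y = 0")
  case False
  then show ?thesis
    using field_hom_mult[of "x / y" y] by (simp add: field_hom_eq_0_iff field_simps)
qed (simp add: field_hom_0)

text \<open>Nodes and weights lie in the image of \<alpha>: the weights can be drawn inside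
  \<alpha>, and a node \<open>\<alpha> b\<close> merges with an argument
  \<open>s = \<alpha> x\<close> into \<open>\<alpha> (b * x)\<close>.\<close>

lemma coeff_extraction_hom:
  assumes "infinite (UNIV :: 'a set)"
  obtains B a where "finite B"
    "\<And>q s. Polynomial.degree q \<le> N \<Longrightarrow> (\<Sum>b\<in>B. \<alpha> (a b) * poly q (\<alpha> b * s)) = coeff q k * s ^ k"
proof -
  obtain B :: "'a set" and a where B: "finite B"
    "\<And>j. j \<le> N \<Longrightarrow> (\<Sum>b\<in>B. a b * b ^ j) = (if j = k then 1 else 0)"
    by (rule coeff_extraction[OF assms, where N = N and k = k]) (rule that)
  have "(\<Sum>b\<in>B. \<alpha> (a b) * poly q (\<alpha> b * s)) = coeff q k * s ^ k"
    if "Polynomial.degree q \<le> N" for q s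
  proof -
    have poly_q: "poly q x = (\<Sum>j\<le>N. coeff q j * x ^ j)" for x
      unfolding poly_altdef using that by (intro sum.mono_neutral_left) (auto simp: coeff_eq_0)
    have "(\<Sum>b\<in>B. \<alpha> (a b) * poly q (\<alpha> b * s))
        = (\<Sum>b\<in>B. \<Sum>j\<le>N. coeff q j * s ^ j * \<alpha> (a b * b ^ j))"
      unfolding poly_q
      by (simp add: sum_distrib_left field_hom_mult field_hom_power power_mult_distrib mult_ac)
    also have "\<dots> = (\<Sum>j\<le>N. coeff q j * s ^ j * \<alpha> (\<Sum>b\<in>B. a b * b ^ j))"
      by (subst sum.swap) (simp add: sum_distrib_left field_hom_sum)
    also have "\<dots> = (\<Sum>j\<le>N. if j = k then coeff q j * s ^ j else 0)"
      by (intro sum.cong) (auto simp: B(2) field_hom_0 field_hom_1)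
    also have "\<dots> = coeff q k * s ^ k"
      using that by (auto simp: coeff_eq_0)
    finally show ?thesis .
  qed
  then show thesis by (rule that[OF B(1)])
qed

end

section \<open>Regular functions and their composites\<close>

text \<open>Both directions of conjugation are assumed to make the situation symmetric: by
  \<open>swap\<close>, each fact about \<open>regular \<rho>\<close> has a counterpart for
  \<open>regular \<sigma>\<close>.\<close>

locale polynomial_conjugation =
  fixes \<sigma> \<rho> :: "('v::finite \<Rightarrow> 'a::field) \<Rightarrow> 'v \<Rightarrow> 'a"
  assumes infinite_field: "infinite (UNIV :: 'a set)"
    and inverse_right: "\<sigma> (\<rho> x) = x"
    and inverse_left: "\<rho> (\<sigma> x) = x"
    and conj: "c \<in> polymap \<Longrightarrow> (\<lambda>x. \<sigma> (c (\<rho> x))) \<in> polymap"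
    and conj_inverse: "c \<in> polymap \<Longrightarrow> (\<lambda>x. \<rho> (c (\<sigma> x))) \<in> polymap"
begin

lemma swap: "polynomial_conjugation \<rho> \<sigma>"
  by unfold_locales (auto simp: infinite_field inverse_left inverse_right conj conj_inverse)

text \<open>Since \<rho> undoes \<sigma>, \<open>r o c o \<rho>\<close> equals
  \<open>(r o \<rho>) o (\<sigma> o c o \<rho>)\<close>, a polynomial function after a polynomial
  map.\<close>

lemma regular_comp_polymap:
  assumes "r \<in> regular \<rho>" "c \<in> polymap"
  shows "(\<lambda>x. r (c x)) \<in> regular \<rho>"
proof -
  have "(\<lambda>y. (\<lambda>z. r (\<rho> z)) (\<sigma> (c (\<rho> y)))) \<in> polyfun"
    using assms by (intro polyfun_comp[OF _ conj]) (auto simp: regular_def)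
  then show ?thesis by (simp add: regular_def inverse_left)
qed

text \<open>Precomposition with the polynomial map that copies coordinate \<open>v\<close> into
  every place turns coordinate \<open>i\<close> into \<open>v\<close>.\<close>

lemma regular1I:
  assumes "(\<lambda>x. r (x i)) \<in> regular \<rho>"
  shows "r \<in> regular1 \<rho>"
  unfolding regular1_def
  using regular_comp_polymap[OF assms, of "\<lambda>x _. x v" for v] by (auto simp: polymap_def polyfun.var)

lemma regular1_comp_poly:
  assumes "r \<in> regular1 \<rho>"
  shows "(\<lambda>s. r (poly q s)) \<in> regular1 \<rho>"
  using regular_comp_polymap[OF regular1D[OF assms], of "\<lambda>x w. poly q (x w)"]
  by (intro regular1I) (auto simp: polymap_def polyfun_poly polyfun.var)

lemma regular1_scale: "r \<in> regular1 \<rho> \<Longrightarrow> (\<lambda>s. r (c * s)) \<in> regular1 \<rho>"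
  using regular1_comp_poly[of r "[:0, c:]"] by (simp add: mult.commute)

text \<open>\<open>G o \<sigma>\<close> is a polynomial map, hence so is its conjugate
  \<open>\<sigma> o G\<close>; and \<open>r o G\<close> is
  \<open>(r o \<rho>) o (\<sigma> o G)\<close>.\<close>

lemma regular_comp:
  assumes "r \<in> regular \<rho>" "\<And>k. G k \<in> regular \<sigma>"
  shows "(\<lambda>x. r (\<lambda>k. G k x)) \<in> polyfun"
proof -
  have "(\<lambda>y k. G k (\<sigma> y)) \<in> polymap"
    using assms(2) by (auto simp: polymap_def regular_def)
  then have "(\<lambda>y. (\<lambda>z. r (\<rho> z)) (\<sigma> (\<lambda>k. G k (\<sigma> (\<rho> y))))) \<in> polyfun"
    using assms(1) by (intro polyfun_comp[OF _ conj]) (auto simp: regular_def)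
  then show ?thesis by (simp add: inverse_left inverse_right)
qed

lemma regular1_comp:
  assumes "r \<in> regular1 \<rho>" "G \<in> regular \<sigma>"
  shows "(\<lambda>x. r (G x)) \<in> polyfun"
  using regular_comp[OF regular1D[OF assms(1)], of "\<lambda>_. G"] assms(2) by simp

lemma regular1_comp_regular1:
  assumes "r \<in> regular1 \<rho>" "g \<in> regular1 \<sigma>"
  shows "\<exists>q. (\<lambda>t. r (g t)) = poly q"
proof -
  fix v :: 'v
  have "(\<lambda>x. r (g (x v))) \<in> polyfun"
    by (rule regular1_comp[OF assms(1) regular1D[OF assms(2)]])
  then show ?thesis by (rule polyfun_univariate)
qed

section \<open>Chain rule for regular functions\<close>

text \<open>The composite is polynomial in two independent variables, so its derivative along the
  diagonal at the origin is the sum of those along the axes.\<close>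

lemma lin_coeff_split:
  assumes "i \<noteq> j" "r \<in> regular1 \<rho>" "(\<lambda>x. H (x i) (x j)) \<in> regular \<sigma>"
  shows "lin_coeff (\<lambda>t. r (H t t)) = lin_coeff (\<lambda>t. r (H t 0)) + lin_coeff (\<lambda>t. r (H 0 t))"
proof -
  have "(\<lambda>x. r (H (x i) (x j))) \<in> polyfun"
    by (rule regular1_comp[OF assms(2,3)])
  then obtain D where D: "\<And>x y. lin_coeff (\<lambda>t. r (H (x i + t * y i) (x j + t * y j))) = (\<Sum>w\<in>UNIV. D w x * y w)"
    by (rule polyfun_lin_coeff[OF infinite_field]) (rule that)
  have "lin_coeff (\<lambda>t. r (H t t)) = (\<Sum>w\<in>UNIV. D w (\<lambda>_. 0) * of_bool (w = i \<or> w = j))"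
    using D[of "\<lambda>_. 0" "\<lambda>w. of_bool (w = i \<or> w = j)"] by simp
  moreover have "lin_coeff (\<lambda>t. r (H t 0)) = (\<Sum>w\<in>UNIV. D w (\<lambda>_. 0) * of_bool (w = i))"
    using D[of "\<lambda>_. 0" "\<lambda>w. of_bool (w = i)"] assms(1) by simp
  moreover have "lin_coeff (\<lambda>t. r (H 0 t)) = (\<Sum>w\<in>UNIV. D w (\<lambda>_. 0) * of_bool (w = j))"
    using D[of "\<lambda>_. 0" "\<lambda>w. of_bool (w = j)"] assms(1) by simp
  moreover have "(\<Sum>w\<in>UNIV. D w (\<lambda>_. 0) * of_bool (w = i \<or> w = j))
      = (\<Sum>w\<in>UNIV. D w (\<lambda>_. 0) * of_bool (w = i) + D w (\<lambda>_. 0) * of_bool (w = j))"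
    using assms(1) by (intro sum.cong) auto
  ultimately show ?thesis
    by (simp only: sum.distrib)
qed

text \<open>\<open>g\<close> and \<open>h\<close> are fed with different variables, so that each
  axis sees only one of them.\<close>

lemma lin_coeff_add:
  assumes "i \<noteq> (j :: 'v)" "r \<in> regular1 \<rho>" "g \<in> regular1 \<sigma>" "h \<in> regular1 \<sigma>" "g 0 = 0" "h 0 = 0"
  shows "lin_coeff (\<lambda>t. r (g t + h t)) = lin_coeff (\<lambda>t. r (g t)) + lin_coeff (\<lambda>t. r (h t))"
  using lin_coeff_split[OF assms(1,2), of "\<lambda>s t. g s + h t"] assms(5,6)
    regular_add[OF regular1D[OF assms(3), of i] regular1D[OF assms(4), of j]] by simp

text \<open>On either axis the product \<open>g s * h t\<close> vanishes, so its composite with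
  \<open>r\<close> is constant there.\<close>

lemma lin_coeff_mult:
  assumes "i \<noteq> (j :: 'v)" "r \<in> regular1 \<rho>" "g \<in> regular1 \<sigma>" "h \<in> regular1 \<sigma>" "g 0 = 0" "h 0 = 0"
  shows "lin_coeff (\<lambda>t. r (g t * h t)) = 0"
  using lin_coeff_split[OF assms(1,2), of "\<lambda>s t. g s * h t"] assms(5,6)
    regular_mult[OF regular1D[OF assms(3), of i] regular1D[OF assms(4), of j]]
  by (simp add: lin_coeff_const[OF infinite_field])

lemma lin_coeff_sum:
  assumes "i \<noteq> (j :: 'v)" "r \<in> regular1 \<rho>" "\<And>k. k \<in> A \<Longrightarrow> g k \<in> regular1 \<sigma>"
    "\<And>k. k \<in> A \<Longrightarrow> g k 0 = 0"
  shows "lin_coeff (\<lambda>t. r (\<Sum>k\<in>A. g k t)) = (\<Sum>k\<in>A. lin_coeff (\<lambda>t. r (g k t)))"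
  using assms(3,4)
proof (induction A rule: infinite_finite_induct)
  case (insert k A)
  then show ?case
    by (simp add: lin_coeff_add[OF assms(1,2)] regular1_sum)
qed (simp_all add: lin_coeff_const[OF infinite_field])

text \<open>Along a line in direction \<open>w\<close>, coordinate \<open>w\<close> of \<sigma>
  after \<rho> has derivative 1. By the chain rule this is a sum over the coordinates of \<rho>, so
  some summand is nonzero; freezing the other arguments of \<sigma> at 0 isolates it.\<close>

lemma nonzero_lin_coeff_pair:
  obtains r g where "r \<in> regular1 \<rho>" "g \<in> regular1 \<sigma>" "g 0 = 0" "lin_coeff (\<lambda>t. r (g t)) \<noteq> 0"
proof -
  fix w :: 'v
  \<comment> \<open>The base point is chosen so that \<rho> maps it to the origin, which makes every
    \<open>g k\<close> vanish at 0.\<close>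
  define z where "z = \<sigma> (\<lambda>_. 0)"
  define line where "line = (\<lambda>t v. z v + (if v = w then t else 0))"
  define g where "g = (\<lambda>k t. \<rho> (line t) k)"
  have "(\<lambda>x. line (x w)) \<in> polymap"
    by (auto simp: polymap_def line_def intro!: polyfun_if polyfun.intros)
  from polymapD[OF conj_inverse[OF this]]
  have g: "g k \<in> regular1 \<sigma>" for k
    by (intro polynomial_conjugation.regular1I[OF swap, of _ w]) (simp add: regular_def g_def)
  have "line 0 = z" by (auto simp: line_def)
  then have g0: "g k 0 = 0" for k
    by (simp add: g_def z_def inverse_left)
  have r0: "(\<lambda>x. \<sigma> x w) \<in> regular \<rho>"
    by (simp add: regular_def inverse_right polyfun.var)
  \<comment> \<open>Each \<open>g k\<close> gets its own variable; setting all variables to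
    \<open>t\<close> recovers the line.\<close>
  have "(\<lambda>x. \<sigma> (\<lambda>k. g k (x k)) w) \<in> polyfun"
    by (rule regular_comp[OF r0]) (rule regular1D[OF g])
  then obtain D where D: "\<And>x y. lin_coeff (\<lambda>t. \<sigma> (\<lambda>k. g k (x k + t * y k)) w) = (\<Sum>k\<in>UNIV. D k x * y k)"
    by (rule polyfun_lin_coeff[OF infinite_field]) (rule that)
  have "lin_coeff (\<lambda>t. \<sigma> (\<lambda>k. g k t) w) = 1"
    using lin_coeff_eqI[OF infinite_field, of "\<lambda>t. \<sigma> (\<lambda>k. g k t) w" "[:z w, 1:]"]
    by (simp add: g_def inverse_right line_def)
  then have "(\<Sum>k\<in>UNIV. D k (\<lambda>_. 0)) \<noteq> 0"
    using D[of "\<lambda>_. 0" "\<lambda>_. 1"] by simp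
  then obtain k where k: "D k (\<lambda>_. 0) \<noteq> 0"
    by (meson sum.neutral)
  define r where "r = (\<lambda>s. \<sigma> (\<lambda>v. if v = k then s else 0) w)"
  have "(\<lambda>x v. if v = k then x k else 0) \<in> polymap"
    by (auto simp: polymap_def intro!: polyfun_if polyfun.intros)
  from regular_comp_polymap[OF r0 this] have r: "r \<in> regular1 \<rho>"
    by (intro regular1I[of _ k]) (simp add: r_def)
  have "r (g k t) = \<sigma> (\<lambda>v. g v (0 + t * of_bool (v = k))) w" for t
    unfolding r_def by (intro arg_cong[of _ _ "\<lambda>x. \<sigma> x w"] ext) (auto simp: g0)
  then have "lin_coeff (\<lambda>t. r (g k t)) = (\<Sum>v\<in>UNIV. D v (\<lambda>_. 0) * of_bool (v = k))"
    by (simp only: D)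
  also have "\<dots> = D k (\<lambda>_. 0)"
    by (simp add: of_bool_def if_distrib[of "\<lambda>c. _ * c"] cong: if_cong)
  finally show thesis
    using that[OF r g g0, of k] k by simp
qed

text \<open>Composing \<open>r (a * g t)\<close> with \<open>r (b * g t) - r 0\<close> places the
  polynomial \<open>g (r x - r 0)\<close> in the middle. Its linear coefficient \<open>q1\<close>
  gives \<open>u a * u b = u (q1 * a * b)\<close>, because the higher terms contribute only
  products; rescaling by \<open>q1\<close> turns the additive \<open>u\<close> into a
  homomorphism.\<close>

lemma lin_coeff_eq_field_hom:
  assumes "i \<noteq> (j :: 'v)" and r: "r \<in> regular1 \<rho>" and g: "g \<in> regular1 \<sigma>" "g 0 = 0"
    and nonzero: "lin_coeff (\<lambda>t. r (g t)) \<noteq> 0"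
  obtains \<alpha> \<kappa> where "field_hom \<alpha>" "\<kappa> \<noteq> 0" "\<And>a. lin_coeff (\<lambda>t. r (a * g t)) = \<alpha> (\<kappa> * a)"
proof -
  define u where "u = (\<lambda>a. lin_coeff (\<lambda>t. r (a * g t)))"
  have ag: "(\<lambda>t. a * g t) \<in> regular1 \<sigma>" for a
    by (intro regular1_mult regular1_const g)
  have "(\<lambda>x. r x + - r 0) \<in> regular1 \<rho>"
    by (intro regular1_add regular1_const r)
  then obtain F where F: "(\<lambda>x. g (r x + - r 0)) = poly F"
    using polynomial_conjugation.regular1_comp_regular1[OF swap g(1)] by blast
  have "poly F 0 = 0"
    using fun_cong[OF F, of 0] g(2) by simp
  then obtain q1 q2 where Fq: "F = pCons 0 (pCons q1 q2)"
    by (metis pCons_cases poly_0 poly_pCons add.right_neutral mult_zero_left)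
  have add: "u (a + b) = u a + u b" for a b
    using lin_coeff_add[OF assms(1) r ag ag, of a b] g(2)
    by (simp add: u_def distrib_right)
  have mult: "u a * u b = u (q1 * a * b)" for a b
  proof -
    obtain H where H: "(\<lambda>t. r (a * g t)) = poly H"
      using regular1_comp_regular1[OF r ag] by blast
    obtain K where K: "(\<lambda>t. r (b * g t)) = poly K"
      using regular1_comp_regular1[OF r ag] by blast
    have K0: "poly K 0 = r 0"
      using fun_cong[OF K, of 0] g(2) by simp
    define K' where "K' = K - [:r 0:]"
    have K': "poly K' t = r (b * g t) + - r 0" for t
      using fun_cong[OF K, of t] by (simp add: K'_def)
    \<comment> \<open>\<open>g t * h t\<close> is the part of \<open>a * poly F (b * g t)\<close>
      beyond the linear term of \<open>F\<close>. Both factors vanish at 0, so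
      \<open>lin_coeff_mult\<close> applies.\<close>
    define h where "h = (\<lambda>t. a * b ^ 2 * (g t * poly q2 (b * g t)))"
    have h: "h \<in> regular1 \<sigma>"
      unfolding h_def by (intro regular1_mult regular1_const g(1) regular1_poly ag)
    have "u a * u b = lin_coeff (\<lambda>t. poly H (poly K' t))"
      by (subst lin_coeff_comp[OF infinite_field])
         (simp_all add: K' K0 g(2) u_def H K lin_coeff_poly[OF infinite_field] K'_def)
    also have "(\<lambda>t. poly H (poly K' t)) = (\<lambda>t. r (q1 * a * b * g t + g t * h t))"
    proof
      fix t
      have "poly H (poly K' t) = r (a * poly F (b * g t))"
        using fun_cong[OF H, of "poly K' t"] fun_cong[OF F, of "b * g t"] by (simp add: K')
      also have "a * poly F (b * g t) = q1 * a * b * g t + g t * h t"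
        by (simp add: Fq h_def algebra_simps power2_eq_square)
      finally show "poly H (poly K' t) = r (q1 * a * b * g t + g t * h t)" .
    qed
    also have "lin_coeff \<dots> = u (q1 * a * b)"
      using lin_coeff_add[OF assms(1) r ag[of "q1 * a * b"] regular1_mult[OF g(1) h]]
        lin_coeff_mult[OF assms(1) r g(1) h g(2)]
      by (simp add: u_def g(2) h_def)
    finally show ?thesis .
  qed
  have u1: "u 1 \<noteq> 0" using nonzero by (simp add: u_def)
  have u0: "u 0 = 0" using add[of 0 0] by (metis add.right_neutral add_left_cancel)
  have q1: "q1 \<noteq> 0"
    using mult[of 1 1] u1 u0 by auto
  define \<alpha> where "\<alpha> = (\<lambda>a. u (a / q1))"
  have \<alpha>_mult: "\<alpha> (x * y) = \<alpha> x * \<alpha> y" for x y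
    using q1 by (simp add: \<alpha>_def mult)
  have "\<alpha> 1 * u 1 = u 1"
    using \<alpha>_mult[of 1 q1] q1 by (simp add: \<alpha>_def)
  then have "field_hom \<alpha>"
    using u1 \<alpha>_mult by (simp add: field_hom_def) (simp add: \<alpha>_def add_divide_distrib add)
  moreover have "lin_coeff (\<lambda>t. r (a * g t)) = \<alpha> (q1 * a)" for a
    using q1 by (simp add: \<alpha>_def u_def)
  ultimately show thesis using that[of \<alpha> q1] q1 by simp
qed

section \<open>A field automorphism regular together with its inverse\<close>

text \<open>The first homomorphism \<alpha> splits \<open>g\<close> into pieces. A suitable piece
  \<gamma> is multiplicative up to a constant, and the homomorphism \<alpha>' obtained from it is
  inverse to \<open>\<gamma> t / \<gamma> 1\<close>.\<close>

lemma field_aut_regular_dim_ge_2: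
  assumes "i \<noteq> (j :: 'v)"
  obtains \<alpha> \<beta> where "field_hom \<alpha>" "\<And>x. \<alpha> (\<beta> x) = x" "\<And>x. \<beta> (\<alpha> x) = x"
    "\<alpha> \<in> regular1 \<rho>" "\<beta> \<in> regular1 \<sigma>"
proof -
  obtain r g where r: "r \<in> regular1 \<rho>" and g: "g \<in> regular1 \<sigma>" "g 0 = 0"
    and rg: "lin_coeff (\<lambda>t. r (g t)) \<noteq> 0"
    by (rule nonzero_lin_coeff_pair)
  obtain \<alpha> \<kappa> where \<alpha>: "field_hom \<alpha>" and \<kappa>: "\<kappa> \<noteq> 0"
    and \<alpha>_eq: "\<And>a. lin_coeff (\<lambda>t. r (a * g t)) = \<alpha> (\<kappa> * a)"
    by (rule lin_coeff_eq_field_hom[OF assms r g rg]) (rule that)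

  \<comment> \<open>The derivative of \<open>r (g x * g y / \<kappa>)\<close> with respect to
    \<open>y\<close> at 0 is polynomial in \<open>x\<close> and equals
    \<open>\<alpha> (g x)\<close>.\<close>
  obtain W where W: "\<And>s. \<alpha> (g s) = poly W s"
  proof -
    have "(\<lambda>x. 1 / \<kappa> * g (x i) * g (x j)) \<in> regular \<sigma>"
      by (intro regular_mult regular_const regular1D g)
    from regular1_comp[OF r this] obtain D where D: "\<And>w. D w \<in> polyfun"
      "\<And>x y. lin_coeff (\<lambda>t. r (1 / \<kappa> * g (x i + t * y i) * g (x j + t * y j))) = (\<Sum>w\<in>UNIV. D w x * y w)"
      by (rule polyfun_lin_coeff[OF infinite_field]) (rule that)
    obtain W where "\<And>s. D j (\<lambda>w. 0 + s * of_bool (w = i)) = poly W s"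
      using polyfun_line[OF D(1)[of j], of "\<lambda>_. 0" "\<lambda>w. of_bool (w = i)"] by blast
    moreover have "D j (\<lambda>w. 0 + s * of_bool (w = i)) = \<alpha> (g s)" for s
      using D(2)[of "\<lambda>w. 0 + s * of_bool (w = i)" "\<lambda>w. of_bool (w = j)"] assms \<kappa> \<alpha>_eq[of "g s / \<kappa>"]
      by (simp add: of_bool_def if_distrib[of "\<lambda>c. _ * c"] cong: if_cong)
    ultimately show thesis by (intro that[of W]) simp
  qed
  have "\<exists>\<gamma>. \<gamma> \<in> regular1 \<sigma> \<and> \<gamma> 0 = 0 \<and> (\<forall>t. \<alpha> (\<gamma> t) = coeff W k * t ^ k)" for k
  proof -
    obtain B a where B: "finite B"
      "\<And>q s. Polynomial.degree q \<le> Polynomial.degree W \<Longrightarrow>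
        (\<Sum>b\<in>B. \<alpha> (a b) * poly q (\<alpha> b * s)) = coeff q k * s ^ k"
      by (rule coeff_extraction_hom[OF \<alpha> infinite_field, where N = "Polynomial.degree W" and k = k])
         (rule that)
    \<comment> \<open>Applying \<alpha> to this function gives the interpolation sum for
      \<open>W\<close>, hence a single monomial.\<close>
    have "(\<lambda>t. \<Sum>b\<in>B. a b * g (\<alpha> b * t)) \<in> regular1 \<sigma>"
      by (intro regular1_sum regular1_mult regular1_const
          polynomial_conjugation.regular1_scale[OF swap] g)
    then show ?thesis
      using B(2)[OF order_refl]
      by (intro exI[of _ "\<lambda>t. \<Sum>b\<in>B. a b * g (\<alpha> b * t)"])
         (simp add: g(2) field_hom_sum[OF \<alpha>] field_hom_mult[OF \<alpha>] W)
  qed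
  then obtain \<gamma>s where \<gamma>s: "\<And>k. \<gamma>s k \<in> regular1 \<sigma>" "\<And>k. \<gamma>s k 0 = 0"
    "\<And>k t. \<alpha> (\<gamma>s k t) = coeff W k * t ^ k"
    by metis
  \<comment> \<open>By injectivity of \<alpha> the pieces add up to \<open>g\<close>, so one of them
    inherits a nonzero linear coefficient.\<close>
  have "g t = (\<Sum>k\<le>Polynomial.degree W. \<gamma>s k t)" for t
    by (rule injD[OF field_hom_inj[OF \<alpha>]])
       (simp add: W field_hom_sum[OF \<alpha>] \<gamma>s(3) poly_altdef)
  then have "lin_coeff (\<lambda>t. r (g t)) = (\<Sum>k\<le>Polynomial.degree W. lin_coeff (\<lambda>t. r (\<gamma>s k t)))"
    using lin_coeff_sum[OF assms r \<gamma>s(1,2)] by simp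
  with rg obtain k where k: "lin_coeff (\<lambda>t. r (\<gamma>s k t)) \<noteq> 0"
    by (metis sum.neutral)
  define \<gamma> where "\<gamma> = \<gamma>s k"
  have \<gamma>: "\<gamma> \<in> regular1 \<sigma>" "\<gamma> 0 = 0" and r\<gamma>: "lin_coeff (\<lambda>t. r (\<gamma> t)) \<noteq> 0"
    and \<alpha>\<gamma>: "\<And>t. \<alpha> (\<gamma> t) = coeff W k * t ^ k"
    using \<gamma>s k by (auto simp: \<gamma>_def)
  \<comment> \<open>Otherwise the monomial \<open>\<alpha> o \<gamma>\<close>, and with it \<gamma>,
    would vanish identically, making \<open>r o \<gamma>\<close> constant.\<close>
  have "\<gamma> 1 \<noteq> 0"
  proof
    assume "\<gamma> 1 = 0"
    then have "\<alpha> (\<gamma> t) = \<alpha> 0" for t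
      using \<alpha>\<gamma>[of 1] \<alpha>\<gamma>[of t] by (simp add: field_hom_0[OF \<alpha>])
    then have "\<gamma> t = 0" for t
      using injD[OF field_hom_inj[OF \<alpha>]] by blast
    with r\<gamma> lin_coeff_const[OF infinite_field, of "r 0"] show False by simp
  qed

  define c where "c = \<gamma> 1"
  \<comment> \<open>Normalized so that \<open>\<alpha> (\<beta> l) = l ^ k\<close>, which makes
    \<open>\<gamma> (l * t) = \<beta> l * \<gamma> t\<close>.\<close>
  define \<beta> where "\<beta> = (\<lambda>t. 1 / c * \<gamma> t)"
  have c: "c \<noteq> 0" by (simp add: c_def \<open>\<gamma> 1 \<noteq> 0\<close>)
  have \<gamma>_eq: "\<gamma> t = c * \<beta> t" for t
    using c by (simp add: \<beta>_def)
  have \<beta>: "\<beta> \<in> regular1 \<sigma>"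
    unfolding \<beta>_def by (intro regular1_mult regular1_const \<gamma>)
  have scale: "\<gamma> (l * t) = \<beta> l * \<gamma> t" for l t
  proof (rule injD[OF field_hom_inj[OF \<alpha>]])
    have "coeff W k \<noteq> 0"
      using \<alpha>\<gamma>[of 1] c by (simp add: c_def[symmetric]) (metis field_hom_eq_0_iff[OF \<alpha>])
    then have "\<alpha> (\<beta> l) = l ^ k"
      using \<alpha>\<gamma>[of 1] \<alpha>\<gamma>[of l] c
      by (simp add: \<beta>_def field_hom_divide[OF \<alpha>] c_def[symmetric] field_hom_eq_0_iff[OF \<alpha>])
    then show "\<alpha> (\<gamma> (l * t)) = \<alpha> (\<beta> l * \<gamma> t)"
      by (simp add: field_hom_mult[OF \<alpha>] \<alpha>\<gamma> power_mult_distrib mult_ac)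
  qed
  obtain \<alpha>' \<kappa>' where \<alpha>': "field_hom \<alpha>'"
    and \<alpha>'_eq: "\<And>a. lin_coeff (\<lambda>t. r (a * \<gamma> t)) = \<alpha>' (\<kappa>' * a)"
    by (rule lin_coeff_eq_field_hom[OF assms r \<gamma> r\<gamma>]) (rule that)
  obtain H where H: "(\<lambda>t. r (\<gamma> t)) = poly H"
    using regular1_comp_regular1[OF r \<gamma>(1)] by blast
  have H1: "coeff H 1 \<noteq> 0"
    using r\<gamma> by (simp add: H lin_coeff_poly[OF infinite_field])
  have inv1: "\<alpha>' (\<beta> l) = l" for l
  proof -
    \<comment> \<open>One linear coefficient computed twice: rescaling the argument yields the
      factor \<open>l\<close>, and \<open>scale\<close> yields the factor
      \<open>\<alpha>' (\<beta> l)\<close>.\<close>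
    have "lin_coeff (\<lambda>t. r (\<gamma> (l * t))) = l * coeff H 1"
      using lin_coeff_eqI[OF infinite_field, of "\<lambda>t. r (\<gamma> (l * t))" "pcompose H [:0, l:]"]
        fun_cong[OF H] by (simp add: poly_pcompose coeff_pcompose_linear mult.commute)
    moreover have "lin_coeff (\<lambda>t. r (\<gamma> (l * t))) = coeff H 1 * \<alpha>' (\<beta> l)"
      using \<alpha>'_eq[of 1] \<alpha>'_eq[of "\<beta> l"]
      by (simp add: scale H lin_coeff_poly[OF infinite_field] field_hom_mult[OF \<alpha>'])
    ultimately show ?thesis using H1 by simp
  qed
  have inv2: "\<beta> (\<alpha>' x) = x" for x
    by (rule injD[OF field_hom_inj[OF \<alpha>']]) (rule inv1)
  have "\<alpha>' \<in> regular1 \<rho>"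
  proof -
    obtain B a where B: "finite B"
      "\<And>q s. Polynomial.degree q \<le> Polynomial.degree H \<Longrightarrow>
        (\<Sum>b\<in>B. \<alpha>' (a b) * poly q (\<alpha>' b * s)) = coeff q 1 * s ^ 1"
      by (rule coeff_extraction_hom[OF \<alpha>' infinite_field, where N = "Polynomial.degree H" and k = 1])
         (rule that)
    \<comment> \<open>\<open>H\<close> at \<open>\<alpha>' (b * x)\<close> is a value of
      \<open>r\<close>, since \<gamma> is \<open>c\<close> times the inverse of \<alpha>'.
      Interpolation then expresses the linear term of \<open>H\<close> at \<open>\<alpha>' x\<close>
      by such values.\<close>
    have "poly H (\<alpha>' b * \<alpha>' x) = r (c * b * x)" for b x
      using fun_cong[OF H, of "\<alpha>' (b * x)"] inv2[of "b * x"]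
      by (simp add: \<gamma>_eq field_hom_mult[OF \<alpha>'] mult.assoc)
    then have "(\<Sum>b\<in>B. \<alpha>' (a b) * r (c * b * x)) = coeff H 1 * \<alpha>' x" for x
      using B(2)[OF order_refl, of "\<alpha>' x"] by simp
    then have "\<alpha>' = (\<lambda>x. 1 / coeff H 1 * (\<Sum>b\<in>B. \<alpha>' (a b) * r (c * b * x)))"
      using H1 by (simp add: fun_eq_iff)
    also have "\<dots> \<in> regular1 \<rho>"
      by (intro regular1_sum regular1_mult regular1_const regular1_scale r)
    finally show ?thesis .
  qed
  then show thesis using that \<alpha>' inv1 inv2 \<beta> by blast
qed

text \<open>Conjugation by the bijection \<open>s\<close> of the field preserves the polynomials
  with polynomial inverse, which are affine. Applied to translations and scalings, this makes the
  normalized \<open>s\<close> additive and multiplicative.\<close>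

lemma field_aut_regular_dim_1:
  assumes single: "\<And>i j :: 'v. i = j"
  obtains \<alpha> \<beta> where "field_hom \<alpha>" "\<And>x. \<alpha> (\<beta> x) = x" "\<And>x. \<beta> (\<alpha> x) = x"
    "\<alpha> \<in> regular1 \<rho>" "\<beta> \<in> regular1 \<sigma>"
proof -
  fix v :: 'v
  have pt: "(\<lambda>_. x v) = x" for x :: "'v \<Rightarrow> 'a"
    using single by (metis ext)
  define s where "s = (\<lambda>a. \<sigma> (\<lambda>_. a) v)"
  define p where "p = (\<lambda>a. \<rho> (\<lambda>_. a) v)"
  have sp: "s (p a) = a" and ps: "p (s a) = a" for a
    by (simp_all add: s_def p_def pt inverse_left inverse_right)
  have conj_poly: "\<exists>q'. \<forall>a. s (poly q (p a)) = poly q' a" for q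
  proof -
    have "(\<lambda>x w. poly q (x v)) \<in> polymap"
      by (auto simp: polymap_def intro: polyfun_poly polyfun.var)
    from polymapD[OF conj[OF this], of v] have "(\<lambda>x. s (poly q (p (x v)))) \<in> polyfun"
      by (simp add: s_def p_def pt)
    then show ?thesis using polyfun_univariate[of "\<lambda>a. s (poly q (p a))" v] by (metis (no_types))
  qed
  have affine: "\<exists>m l. \<forall>x. s (poly q x) = m + l * s x"
    if "\<And>x. poly q (poly q' x) = x" for q q'
  proof -
    obtain Q where Q: "\<And>a. s (poly q (p a)) = poly Q a" using conj_poly by blast
    obtain Q' where Q': "\<And>a. s (poly q' (p a)) = poly Q' a" using conj_poly by blast
    have "poly (pcompose Q Q') a = poly [:0, 1:] a" for a
      using that by (simp add: poly_pcompose Q[symmetric] Q'[symmetric] sp ps)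
    then have "pcompose Q Q' = [:0, 1:]"
      by (rule poly_eqI_infinite[OF infinite_field])
    \<comment> \<open>Degrees multiply under composition, so both are 1.\<close>
    then have "Polynomial.degree Q * Polynomial.degree Q' = 1"
      by (metis degree_pcompose degree_pCons_eq_if degree_1 one_poly_eq_simps(1) pCons_eq_0_iff
          One_nat_def zero_neq_one degree_0)
    then obtain m l where "Q = [:m, l:]"
      by (metis nat_mult_eq_1_iff degree1_coeffs)
    then have "s (poly q x) = m + l * s x" for x
      using Q[of "s x"] by (simp add: ps mult.commute)
    then show ?thesis by blast
  qed
  define c where "c = s 1 - s 0"
  have c: "c \<noteq> 0" unfolding c_def by (metis ps right_minus_eq zero_neq_one)
  \<comment> \<open>The affine normalization of \<open>s\<close> that fixes 0 and 1.\<close>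
  define \<alpha> where "\<alpha> = (\<lambda>a. (s a - s 0) / c)"
  define \<beta> where "\<beta> = (\<lambda>a. p (s 0 + c * a))"
  have inv1: "\<alpha> (\<beta> x) = x" and inv2: "\<beta> (\<alpha> x) = x" for x
    using c by (simp_all add: \<alpha>_def \<beta>_def sp ps)
  have \<alpha>0: "\<alpha> 0 = 0" and \<alpha>1: "\<alpha> 1 = 1" and s_eq: "s x = s 0 + c * \<alpha> x" for x
    using c by (simp_all add: \<alpha>_def c_def)
  have affine': "\<exists>l. \<forall>x. \<alpha> (poly q x) = \<alpha> (poly q 0) + l * \<alpha> x"
    if inv: "\<And>x. poly q (poly q' x) = x" for q q'
  proof -
    obtain m l where ml: "\<And>x. s (poly q x) = m + l * s x" using affine[OF inv] by blast
    have "\<alpha> (poly q x) = \<alpha> (poly q 0) + l * \<alpha> x" for x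
      using c by (simp add: \<alpha>_def ml field_simps)
    then show ?thesis by blast
  qed
  have add: "\<alpha> (x + b) = \<alpha> x + \<alpha> b" for x b
  proof (cases "b = 0")
    case False
    obtain l where l: "\<And>x. \<alpha> (b + x) = \<alpha> b + l * \<alpha> x"
      using affine'[of "[:b, 1:]" "[:- b, 1:]"] by auto
    \<comment> \<open>A slope other than 1 would give the conjugated translation a fixed point,
      whereas translation by a nonzero \<open>b\<close> has none.\<close>
    have "l = 1"
    proof (rule ccontr)
      assume "l \<noteq> 1"
      define y where "y = \<beta> (\<alpha> b / (1 - l))"
      have "\<alpha> (b + y) = \<alpha> y"
        using \<open>l \<noteq> 1\<close> by (simp add: l y_def inv1 field_simps)
      then have "b + y = y" by (metis inv2)
      with False show False by simp
    qed
    with l[of x] show ?thesis by (simp add: add.commute)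
  qed (simp add: \<alpha>0)
  have mult: "\<alpha> (x * b) = \<alpha> x * \<alpha> b" for x b
  proof (cases "b = 0")
    case False
    then obtain l where l: "\<And>x. \<alpha> (x * b) = l * \<alpha> x"
      using affine'[of "[:0, b:]" "[:0, 1 / b:]"] by (auto simp: \<alpha>0)
    then show ?thesis using l[of 1] by (simp add: \<alpha>1 l mult.commute[of _ l])
  qed (simp add: \<alpha>0)
  have \<alpha>: "field_hom \<alpha>"
    by (simp add: field_hom_def add mult \<alpha>1)
  have "(\<lambda>y. y v * (1 / c) + - (s 0 / c)) \<in> polyfun"
    by (intro polyfun.intros)
  moreover have "\<alpha> (\<rho> y v) = y v * (1 / c) + - (s 0 / c)" for y
    by (simp add: \<alpha>_def s_def pt inverse_right diff_divide_distrib)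
  ultimately have "\<alpha> \<in> regular1 \<rho>"
    by (intro regular1I[of _ v]) (simp add: regular_def)
  moreover have "\<beta> (\<sigma> x v) = \<beta> (s 0) + \<beta> c * x v" for x
  proof -
    have "\<alpha> (\<beta> (s 0) + \<beta> c * x v) = s (x v)"
      by (simp add: add mult inv1 s_eq[of "x v"])
    then show ?thesis
      by (metis inv2 s_def pt)
  qed
  then have "\<beta> \<in> regular1 \<sigma>"
    by (intro polynomial_conjugation.regular1I[OF swap, of _ v])
       (auto simp: regular_def intro!: polyfun.intros)
  ultimately show thesis using that \<alpha> inv1 inv2 by blast
qed

lemma field_aut_regular:
  obtains \<alpha> \<beta> where "field_hom \<alpha>" "\<And>x. \<alpha> (\<beta> x) = x" "\<And>x. \<beta> (\<alpha> x) = x"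
    "\<alpha> \<in> regular1 \<rho>" "\<beta> \<in> regular1 \<sigma>"
  using field_aut_regular_dim_ge_2 field_aut_regular_dim_1 by metis

end

section \<open>Points and endomorphisms of the polynomial algebra\<close>

definition mvar :: "'v \<Rightarrow> ('v, 'a::zero_neq_one) mpoly" where
  "mvar v = Poly_Mapping.single (Poly_Mapping.single v 1) 1"

definition monom_eval :: "('v \<Rightarrow> 'b::comm_semiring_1) \<Rightarrow> ('v \<Rightarrow>\<^sub>0 nat) \<Rightarrow> 'b" where
  "monom_eval x m = (\<Prod>v\<in>UNIV. x v ^ Poly_Mapping.lookup m v)"

text \<open>\<open>h\<close> carries coefficients into the target ring: the identity gives
  evaluation at a point, \<open>pconst\<close> gives substitution of polynomials.\<close>

definition insertion :: "('a::zero \<Rightarrow> 'b::comm_semiring_1) \<Rightarrow> ('v \<Rightarrow> 'b) \<Rightarrow> ('v, 'a) mpoly \<Rightarrow> 'b" where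
  "insertion h x p = (\<Sum>m\<in>Poly_Mapping.keys p. h (Poly_Mapping.lookup p m) * monom_eval x m)"

lemma monom_eval_0 [simp]: "monom_eval x 0 = 1"
  by (simp add: monom_eval_def)

lemma monom_eval_add: "monom_eval x (m + n) = monom_eval x m * monom_eval x n"
  by (simp add: monom_eval_def lookup_add power_add prod.distrib)

lemma monom_eval_mult: "monom_eval (\<lambda>v. x v * y v) m = monom_eval x m * monom_eval y m"
  by (simp add: monom_eval_def power_mult_distrib prod.distrib)

lemma monom_eval_single:
  fixes x :: "'v::finite \<Rightarrow> 'b::comm_semiring_1"
  shows "monom_eval x (Poly_Mapping.single v n) = x v ^ n"
proof -
  have "monom_eval x (Poly_Mapping.single v n) = (\<Prod>w\<in>UNIV. if w = v then x w ^ n else 1)"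
    unfolding monom_eval_def by (intro prod.cong) (auto simp: lookup_single when_def)
  then show ?thesis by simp
qed

lemma mpoly_single_induct:
  assumes "\<And>m c. P (Poly_Mapping.single m c)" "\<And>p q. P p \<Longrightarrow> P q \<Longrightarrow> P (p + q)"
  shows "P (p :: ('v, 'a::comm_monoid_add) mpoly)"
proof -
  have "P (\<Sum>m\<in>A. Poly_Mapping.single m (Poly_Mapping.lookup p m))" for A
    by (induction A rule: infinite_finite_induct)
       (use assms assms(1)[of 0 0] in auto)
  moreover have "p = (\<Sum>m\<in>Poly_Mapping.keys p. Poly_Mapping.single m (Poly_Mapping.lookup p m))"
    by (rule poly_mapping_eqI)
       (auto simp: lookup_sum lookup_single when_def in_keys_iff if_distrib cong: if_cong)
  ultimately show ?thesis by metis
qed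

lemma mvar_power:
  "mvar v ^ n = (Poly_Mapping.single (Poly_Mapping.single v n) 1 :: ('v, 'a::comm_semiring_1) mpoly)"
  by (induction n) (simp_all add: mvar_def mult_single single_add[symmetric])

lemma monom_eval_mvar:
  fixes m :: "'v::finite \<Rightarrow>\<^sub>0 nat"
  shows "monom_eval mvar m = (Poly_Mapping.single m 1 :: ('v, 'a::comm_semiring_1) mpoly)"
proof -
  have "(\<Prod>v\<in>A. mvar v ^ n v)
      = (Poly_Mapping.single (\<Sum>v\<in>A. Poly_Mapping.single v (n v)) 1 :: ('v, 'a) mpoly)"
    for A and n :: "'v \<Rightarrow> nat"
    by (induction A rule: infinite_finite_induct) (simp_all add: mvar_power mult_single)
  moreover have "(\<Sum>v\<in>UNIV. Poly_Mapping.single v (Poly_Mapping.lookup m v)) = m"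
    by (rule poly_mapping_eqI)
       (simp add: lookup_sum lookup_single when_def)
  ultimately show ?thesis by (simp add: monom_eval_def)
qed

lemma mpoly_induct [case_names const var add mult]:
  fixes p :: "('v::finite, 'a::comm_ring_1) mpoly"
  assumes const: "\<And>c. P (pconst c)" and var: "\<And>v. P (mvar v)"
    and add: "\<And>p q. P p \<Longrightarrow> P q \<Longrightarrow> P (p + q)" and mult: "\<And>p q. P p \<Longrightarrow> P q \<Longrightarrow> P (p * q)"
  shows "P p"
proof (induction p rule: mpoly_single_induct)
  case (1 m c)
  have one: "P 1" using const[of 1] by (simp add: pconst_def)
  then have power: "P (mvar v ^ n)" for v n
    by (induction n) (auto intro: var mult)
  have "P (\<Prod>v\<in>A. mvar v ^ Poly_Mapping.lookup m v)" for A
    by (induction A rule: infinite_finite_induct) (auto intro: one mult power)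
  then have "P (pconst c * monom_eval mvar m)"
    unfolding monom_eval_def by (intro mult const)
  then show ?case by (simp add: monom_eval_mvar pconst_def mult_single)
qed (rule add)

lemma insertion_superset:
  assumes "finite A" "Poly_Mapping.keys p \<subseteq> A" "h 0 = 0"
  shows "insertion h x p = (\<Sum>m\<in>A. h (Poly_Mapping.lookup p m) * monom_eval x m)"
  unfolding insertion_def
  using assms by (intro sum.mono_neutral_left) (auto simp: in_keys_iff)

context
  fixes h :: "'a::comm_ring_1 \<Rightarrow> 'b::comm_ring_1"
  assumes h_add: "\<And>a b. h (a + b) = h a + h b" and h_mult: "\<And>a b. h (a * b) = h a * h b"
    and h_1: "h 1 = 1"
begin

lemma coeff_hom_0: "h 0 = 0"
  using h_add[of 0 0] by (metis add.right_neutral add_left_cancel)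

lemma insertion_single: "insertion h x (Poly_Mapping.single m c) = h c * monom_eval x m"
  by (subst insertion_superset[of "{m}"]) (auto simp: coeff_hom_0)

lemma insertion_add: "insertion h x (p + q) = insertion h x p + insertion h x q"
  by (subst (1 2 3) insertion_superset[of "Poly_Mapping.keys p \<union> Poly_Mapping.keys q"])
     (use keys_add[of p q] in \<open>auto simp: coeff_hom_0 h_add lookup_add distrib_right sum.distrib\<close>)

lemma insertion_pconst: "insertion h x (pconst c) = h c"
  by (simp add: pconst_def insertion_single)

lemma insertion_mvar: "insertion h (x :: 'v::finite \<Rightarrow> 'b) (mvar v) = x v"
  by (simp add: mvar_def insertion_single h_1 monom_eval_single)

lemma insertion_mult: "insertion h x (p * q) = insertion h x p * insertion h x q"
proof (induction p rule: mpoly_single_induct)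
  case (1 m c)
  show ?case
    by (induction q rule: mpoly_single_induct)
       (simp_all add: mult_single insertion_single insertion_add h_mult monom_eval_add distrib_left distrib_right mult_ac)
qed (simp add: distrib_right insertion_add)

end

definition mpoly_eval :: "('v \<Rightarrow> 'a::comm_ring_1) \<Rightarrow> ('v, 'a) mpoly \<Rightarrow> 'a" where
  "mpoly_eval = insertion (\<lambda>c. c)"

lemma mpoly_eval_simps [simp]:
  "mpoly_eval x (pconst c) = c"
  "mpoly_eval x (p + q) = mpoly_eval x p + mpoly_eval x q"
  "mpoly_eval x (p * q) = mpoly_eval x p * mpoly_eval x q"
  unfolding mpoly_eval_def
  by (simp_all add: insertion_pconst insertion_add insertion_mult)

lemma mpoly_eval_mvar [simp]: "mpoly_eval x (mvar v) = x v" for x :: "'v::finite \<Rightarrow> 'a::comm_ring_1"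
  by (simp add: mpoly_eval_def insertion_mvar)

lemma mpoly_eval_polyfun: "(\<lambda>x. mpoly_eval x p) \<in> polyfun"
  unfolding mpoly_eval_def insertion_def monom_eval_def
  by (intro polyfun_sum polyfun_prod polyfun_power polyfun.intros)

lemma polyfun_imp_mpoly_eval:
  fixes f :: "('v::finite \<Rightarrow> 'a::comm_ring_1) \<Rightarrow> 'a"
  assumes "f \<in> polyfun"
  shows "\<exists>p. \<forall>x. mpoly_eval x p = f x"
  using assms
proof induction
  case (const c)
  then show ?case by (intro exI[of _ "pconst c"]) simp
next
  case (var v)
  then show ?case by (intro exI[of _ "mvar v"]) simp
next
  case (add f g)
  then show ?case by (metis mpoly_eval_simps(2))
next
  case (mult f g)
  then show ?case by (metis mpoly_eval_simps(3))
qed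

section \<open>Polynomials are determined by their values\<close>

lemma monom_eval_separates:
  fixes m n :: "'v::finite \<Rightarrow>\<^sub>0 nat"
  assumes "infinite (UNIV :: 'a::idom set)" "m \<noteq> n"
  shows "\<exists>x :: 'v \<Rightarrow> 'a. monom_eval x m \<noteq> monom_eval x n"
proof -
  obtain v where v: "Poly_Mapping.lookup m v \<noteq> Poly_Mapping.lookup n v"
    using assms(2) by (meson poly_mapping_eqI)
  have "monom 1 (Poly_Mapping.lookup m v) \<noteq> (monom 1 (Poly_Mapping.lookup n v) :: 'a poly)"
    using v by (simp add: monom_eq_iff')
  then obtain t :: 'a where t: "t ^ Poly_Mapping.lookup m v \<noteq> t ^ Poly_Mapping.lookup n v"
    using poly_eqI_infinite[OF assms(1), of "monom 1 (Poly_Mapping.lookup m v)" "monom 1 (Poly_Mapping.lookup n v)"]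
    by (auto simp: poly_monom)
  \<comment> \<open>At this point only the exponent of \<open>v\<close> is visible.\<close>
  have "monom_eval (\<lambda>w. if w = v then t else 1) k = t ^ Poly_Mapping.lookup k v" for k
  proof -
    have "monom_eval (\<lambda>w. if w = v then t else 1) k = (\<Prod>w\<in>UNIV. if w = v then t ^ Poly_Mapping.lookup k w else 1)"
      unfolding monom_eval_def by (intro prod.cong) auto
    then show ?thesis by simp
  qed
  with t show ?thesis by metis
qed

text \<open>Monomials are distinct multiplicative characters, so Dedekind's argument applies.\<close>

lemma monom_eval_independent:
  fixes c :: "('v::finite \<Rightarrow>\<^sub>0 nat) \<Rightarrow> 'a::idom"
  assumes "infinite (UNIV :: 'a set)" "finite A" "\<And>x. (\<Sum>m\<in>A. c m * monom_eval x m) = 0" "m \<in> A"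
  shows "c m = 0"
  using assms(2-4)
proof (induction A arbitrary: c m rule: finite_induct)
  case (insert n A)
  have zero: "c k = 0" if k: "k \<in> A" for k
  proof -
    obtain y :: "'v \<Rightarrow> 'a" where y: "monom_eval y k \<noteq> monom_eval y n"
      using monom_eval_separates[OF assms(1), of k n] insert.hyps k by blast
    \<comment> \<open>Replacing \<open>x\<close> by the coordinatewise product with \<open>y\<close>
      and subtracting \<open>monom_eval y n\<close> times the original relation eliminates
      \<open>n\<close>; the factor at \<open>k\<close> is nonzero.\<close>
    have "(\<Sum>m\<in>A. c m * (monom_eval y m - monom_eval y n) * monom_eval x m) = 0" for x
    proof -
      have "(\<Sum>m\<in>A. c m * (monom_eval y m - monom_eval y n) * monom_eval x m)
          = (\<Sum>m\<in>insert n A. c m * (monom_eval y m - monom_eval y n) * monom_eval x m)"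
        using insert.hyps by simp
      also have "\<dots> = (\<Sum>m\<in>insert n A. c m * monom_eval (\<lambda>v. x v * y v) m)
          - monom_eval y n * (\<Sum>m\<in>insert n A. c m * monom_eval x m)"
        unfolding sum_distrib_left sum_subtractf[symmetric]
        by (intro sum.cong) (simp_all add: monom_eval_mult algebra_simps)
      also have "\<dots> = 0"
        by (simp only: insert.prems(1) mult_zero_right diff_self)
      finally show ?thesis .
    qed
    from insert.IH[OF this k] y show ?thesis by simp
  qed
  have "c n = 0"
    using insert.prems(1)[of "\<lambda>_. 1"] insert.hyps zero by (simp add: monom_eval_def)
  with zero insert.prems(2) show ?case by auto
qed simp

lemma mpoly_eqI:
  fixes p q :: "('v::finite, 'a::idom) mpoly"
  assumes "infinite (UNIV :: 'a set)" "\<And>x. mpoly_eval x p = mpoly_eval x q"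
  shows "p = q"
proof (rule poly_mapping_eqI)
  fix m
  define A where "A = insert m (Poly_Mapping.keys p \<union> Poly_Mapping.keys q)"
  have "(\<Sum>k\<in>A. (Poly_Mapping.lookup p k - Poly_Mapping.lookup q k) * monom_eval x k) = 0" for x
  proof -
    have "mpoly_eval x r = (\<Sum>k\<in>A. Poly_Mapping.lookup r k * monom_eval x k)" if "r \<in> {p, q}" for r
      unfolding mpoly_eval_def using that
      by (subst insertion_superset[of A]) (auto simp: A_def)
    with assms(2)[of x] show ?thesis
      by (simp add: left_diff_distrib sum_subtractf)
  qed
  from monom_eval_independent[OF assms(1) _ this, of m] show "Poly_Mapping.lookup p m = Poly_Mapping.lookup q m"
    by (simp add: A_def)
qed

section \<open>Endomorphisms as polynomial maps\<close>

text \<open>The map of affine space dual to \<open>s\<close>; the duality reverses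
  composition.\<close>

definition point_map :: "(('v, 'a::comm_ring_1) mpoly \<Rightarrow> ('v, 'a) mpoly) \<Rightarrow> ('v \<Rightarrow> 'a) \<Rightarrow> ('v \<Rightarrow> 'a)" where
  "point_map s x = (\<lambda>v. mpoly_eval x (s (mvar v)))"

definition point_endo :: "('v \<Rightarrow> 'a::comm_ring_1) \<Rightarrow> ('v, 'a) mpoly \<Rightarrow> ('v, 'a) mpoly" where
  "point_endo a p = pconst (mpoly_eval a p)"

lemma End_algD:
  assumes "s \<in> End_alg"
  shows "s (p + q) = s p + s q" "s (p * q) = s p * s q" "s 1 = 1" "s (pconst c) = pconst c"
proof -
  show *: "s (p + q) = s p + s q" "s (p * q) = s p * s q" "s 1 = 1"
    using assms by (simp_all add: End_alg_def is_alg_endo_def)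
  have "s (pconst c * 1) = pconst c * s 1"
    using assms unfolding End_alg_def is_alg_endo_def by blast
  then show "s (pconst c) = pconst c"
    by (simp add: *)
qed

lemma pconst_add: "pconst (a + b) = pconst a + (pconst b :: ('v, 'a::comm_ring_1) mpoly)"
  and pconst_mult: "pconst (a * b) = pconst a * (pconst b :: ('v, 'a::comm_ring_1) mpoly)"
  and pconst_one: "pconst 1 = (1 :: ('v, 'a::comm_ring_1) mpoly)"
  by (simp_all add: pconst_def single_add mult_single)

text \<open>Both sides are ring homomorphisms in \<open>p\<close> that agree on constants and
  variables.\<close>

lemma mpoly_eval_End_alg:
  fixes s :: "('v::finite, 'a::field) mpoly \<Rightarrow> ('v, 'a) mpoly"
  assumes "s \<in> End_alg"
  shows "mpoly_eval x (s p) = mpoly_eval (point_map s x) p"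
  by (induction p rule: mpoly_induct) (simp_all add: End_algD[OF assms] point_map_def)

lemma point_map_polymap: "point_map s \<in> polymap"
  by (simp add: polymap_def point_map_def mpoly_eval_polyfun)

lemma End_algI:
  assumes "\<And>p q. s (p + q) = s p + s q" "\<And>p q. s (p * q) = s p * s q" "\<And>c. s (pconst c) = pconst c"
  shows "s \<in> End_alg"
  using assms(3)[of 1] by (simp add: End_alg_def is_alg_endo_def assms pconst_one)

lemma End_alg_comp:
  assumes "s \<in> End_alg" "t \<in> End_alg"
  shows "s \<circ> t \<in> End_alg"
  by (rule End_algI) (simp_all add: End_algD[OF assms(1)] End_algD[OF assms(2)])

lemma id_End_alg: "id \<in> End_alg"
  by (rule End_algI) simp_all

lemma point_map_id: "point_map id x = (x :: 'v::finite \<Rightarrow> 'a::field)"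
  by (simp add: point_map_def)

lemma point_map_comp:
  fixes s t :: "('v::finite, 'a::field) mpoly \<Rightarrow> ('v, 'a) mpoly"
  assumes "s \<in> End_alg"
  shows "point_map (s \<circ> t) x = point_map t (point_map s x)"
  by (simp add: mpoly_eval_End_alg[OF assms] point_map_def[of "s \<circ> t"] point_map_def[of t])

lemma End_alg_eqI:
  fixes s t :: "('v::finite, 'a::field) mpoly \<Rightarrow> ('v, 'a) mpoly"
  assumes "infinite (UNIV :: 'a set)" "s \<in> End_alg" "t \<in> End_alg" "\<And>x. point_map s x = point_map t x"
  shows "s = t"
  by (rule ext, rule mpoly_eqI[OF assms(1)]) (simp add: mpoly_eval_End_alg assms)

text \<open>Choose polynomials representing the coordinates of \<open>c\<close> and substitute them
  for the variables.\<close>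

lemma ex_End_alg_point_map:
  fixes c :: "('v::finite \<Rightarrow> 'a::field) \<Rightarrow> 'v \<Rightarrow> 'a"
  assumes "c \<in> polymap"
  obtains s where "s \<in> End_alg" "point_map s = c"
proof -
  obtain g where g: "\<And>v x. mpoly_eval x (g v) = c x v"
    using polyfun_imp_mpoly_eval[OF polymapD[OF assms]] by metis
  define s where "s = insertion pconst g"
  have "s \<in> End_alg"
    unfolding s_def
    by (rule End_algI) (simp_all add: insertion_add insertion_mult insertion_pconst pconst_add pconst_mult pconst_one)
  moreover have "s (mvar v) = g v" for v
    unfolding s_def by (rule insertion_mvar) (simp_all add: pconst_add pconst_mult pconst_one)
  then have "point_map s = c"
    by (simp add: point_map_def g fun_eq_iff)
  ultimately show thesis by (rule that)
qed

lemma point_endo_End_alg: "point_endo a \<in> End_alg"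
  by (rule End_algI) (simp_all add: point_endo_def pconst_add pconst_mult)

lemma point_endo_comp:
  fixes s :: "('v::finite, 'a::field) mpoly \<Rightarrow> ('v, 'a) mpoly"
  assumes "s \<in> End_alg"
  shows "point_endo a \<circ> s = point_endo (point_map s a)"
  by (simp add: fun_eq_iff point_endo_def mpoly_eval_End_alg[OF assms])

text \<open>Endomorphisms fix constants, which makes every \<open>point_endo a\<close> a right
  zero.\<close>

lemma comp_point_endo:
  assumes "s \<in> End_alg"
  shows "s \<circ> point_endo a = point_endo a"
  by (simp add: fun_eq_iff point_endo_def End_algD[OF assms])

lemma point_endo_inject:
  fixes a b :: "'v::finite \<Rightarrow> 'a::field"
  shows "point_endo a = point_endo b \<longleftrightarrow> a = b"
proof
  assume eq: "point_endo a = point_endo b"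
  show "a = b"
  proof
    fix v
    show "a v = b v"
      using arg_cong[OF fun_cong[OF eq, of "mvar v"], of "mpoly_eval a"] by (simp add: point_endo_def)
  qed
qed simp

text \<open>A right zero absorbs evaluation at the origin on its left, so it is evaluation at the
  image of the origin under its point map.\<close>

lemma right_zero_imp_point_endo:
  fixes t :: "('v::finite, 'a::field) mpoly \<Rightarrow> ('v, 'a) mpoly"
  assumes "infinite (UNIV :: 'a set)" "t \<in> End_alg" "\<And>s. s \<in> End_alg \<Longrightarrow> s \<circ> t = t"
  shows "\<exists>a. t = point_endo a"
proof -
  have "t = point_endo (\<lambda>_. 0) \<circ> t"
    using assms(3)[OF point_endo_End_alg] by simp
  then show ?thesis
    using point_endo_comp[OF assms(2)] by metis
qed

section \<open>The action of a semigroup automorphism on points\<close>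

text \<open>Being a right zero is a semigroup property, preserved because \<tau> is onto.\<close>

lemma semigroup_aut_point_endo:
  fixes \<tau> :: "(('v::finite, 'a::field) mpoly \<Rightarrow> ('v, 'a) mpoly) \<Rightarrow> (('v, 'a) mpoly \<Rightarrow> ('v, 'a) mpoly)"
  assumes "infinite (UNIV :: 'a set)" "is_semigroup_aut_End \<tau>"
  shows "\<exists>a'. \<tau> (point_endo a) = point_endo a'"
proof (rule right_zero_imp_point_endo[OF assms(1)])
  have \<tau>: "bij_betw \<tau> End_alg End_alg"
    "\<And>s t. s \<in> End_alg \<Longrightarrow> t \<in> End_alg \<Longrightarrow> \<tau> (s \<circ> t) = \<tau> s \<circ> \<tau> t"
    using assms(2) by (auto simp: is_semigroup_aut_End_def)
  show "\<tau> (point_endo a) \<in> End_alg"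
    using \<tau>(1) point_endo_End_alg by (rule bij_betwE[THEN bspec])
  fix s :: "('v, 'a) mpoly \<Rightarrow> ('v, 'a) mpoly" assume "s \<in> End_alg"
  then have "s \<in> \<tau> ` End_alg"
    using bij_betw_imp_surj_on[OF \<tau>(1)] by simp
  then obtain s' where s': "s' \<in> End_alg" "s = \<tau> s'"
    by blast
  show "s \<circ> \<tau> (point_endo a) = \<tau> (point_endo a)"
    using \<tau>(2)[OF s'(1) point_endo_End_alg, of a] by (simp add: s' comp_point_endo)
qed

lemma semigroup_aut_inverse:
  assumes "is_semigroup_aut_End \<tau>"
  shows "is_semigroup_aut_End (inv_into End_alg \<tau>)"
proof -
  have \<tau>: "bij_betw \<tau> End_alg End_alg"
    "\<And>s t. s \<in> End_alg \<Longrightarrow> t \<in> End_alg \<Longrightarrow> \<tau> (s \<circ> t) = \<tau> s \<circ> \<tau> t"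
    using assms by (auto simp: is_semigroup_aut_End_def)
  have inv: "bij_betw (inv_into End_alg \<tau>) End_alg End_alg"
    by (rule bij_betw_inv_into[OF \<tau>(1)])
  have "inv_into End_alg \<tau> (s \<circ> t) = inv_into End_alg \<tau> s \<circ> inv_into End_alg \<tau> t"
    if "s \<in> End_alg" "t \<in> End_alg" for s t
  proof -
    have mem: "inv_into End_alg \<tau> s \<in> End_alg" "inv_into End_alg \<tau> t \<in> End_alg"
      using inv that by (auto dest: bij_betwE)
    have "s \<circ> t = \<tau> (inv_into End_alg \<tau> s \<circ> inv_into End_alg \<tau> t)"
      using \<tau> mem that by (simp add: bij_betw_inv_into_right)
    then show ?thesis
      using \<tau>(1) mem by (simp add: bij_betw_inv_into_left End_alg_comp)
  qed
  with inv show ?thesis by (simp add: is_semigroup_aut_End_def)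
qed

text \<open>Apply \<tau> to \<open>point_endo a o s = point_endo (point_map s a)\<close>.\<close>

lemma point_map_semigroup_aut:
  fixes \<tau> :: "(('v::finite, 'a::field) mpoly \<Rightarrow> ('v, 'a) mpoly) \<Rightarrow> (('v, 'a) mpoly \<Rightarrow> ('v, 'a) mpoly)"
  assumes "is_semigroup_aut_End \<tau>" "\<And>a. \<tau> (point_endo a) = point_endo (\<sigma> a)" "s \<in> End_alg"
  shows "point_map (\<tau> s) (\<sigma> a) = \<sigma> (point_map s a)"
proof -
  have mem: "\<tau> s \<in> End_alg"
    using assms(1,3) by (auto simp: is_semigroup_aut_End_def dest: bij_betwE)
  have "point_endo (\<sigma> (point_map s a)) = \<tau> (point_endo a \<circ> s)"
    by (simp add: assms(2) point_endo_comp[OF assms(3)])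
  also have "\<dots> = point_endo (\<sigma> a) \<circ> \<tau> s"
    using assms(1) assms(3) point_endo_End_alg[of a]
    unfolding is_semigroup_aut_End_def assms(2)[symmetric] by blast
  also have "\<dots> = point_endo (point_map (\<tau> s) (\<sigma> a))"
    by (rule point_endo_comp[OF mem])
  finally show ?thesis by (simp add: point_endo_inject)
qed

text \<open>\<sigma> and \<rho> are the actions of \<tau> and its inverse on points. Every
  polynomial map is the point map of an endomorphism, so its conjugate is again a point map.\<close>

lemma semigroup_aut_polynomial_conjugation:
  fixes \<tau> :: "(('v::finite, 'a::field) mpoly \<Rightarrow> ('v, 'a) mpoly) \<Rightarrow> (('v, 'a) mpoly \<Rightarrow> ('v, 'a) mpoly)"
  assumes "infinite (UNIV :: 'a set)" "is_semigroup_aut_End \<tau>"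
  obtains \<sigma> \<rho> where "polynomial_conjugation \<sigma> \<rho>"
    "\<And>s a. s \<in> End_alg \<Longrightarrow> point_map (\<tau> s) (\<sigma> a) = \<sigma> (point_map s a)"
proof -
  define \<tau>' where "\<tau>' = inv_into End_alg \<tau>"
  have \<tau>': "is_semigroup_aut_End \<tau>'"
    unfolding \<tau>'_def by (rule semigroup_aut_inverse[OF assms(2)])
  have bij: "bij_betw \<tau> End_alg End_alg"
    using assms(2) by (simp add: is_semigroup_aut_End_def)
  obtain \<sigma> where \<sigma>: "\<And>a. \<tau> (point_endo a) = point_endo (\<sigma> a)"
    using semigroup_aut_point_endo[OF assms] by metis
  obtain \<rho> where \<rho>: "\<And>a. \<tau>' (point_endo a) = point_endo (\<rho> a)"
    using semigroup_aut_point_endo[OF assms(1) \<tau>'] by metis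
  have \<sigma>\<rho>: "\<sigma> (\<rho> a) = a" for a
    using bij_betw_inv_into_right[OF bij, of "point_endo a"] \<sigma> \<rho> point_endo_End_alg
    by (metis \<tau>'_def point_endo_inject)
  have \<rho>\<sigma>: "\<rho> (\<sigma> a) = a" for a
    using bij_betw_inv_into_left[OF bij, of "point_endo a"] \<sigma> \<rho> point_endo_End_alg
    by (metis \<tau>'_def point_endo_inject)
  have star: "point_map (\<tau> s) (\<sigma> a) = \<sigma> (point_map s a)" if "s \<in> End_alg" for s a
    by (rule point_map_semigroup_aut[OF assms(2) \<sigma> that])
  have star': "point_map (\<tau>' s) (\<rho> a) = \<rho> (point_map s a)" if "s \<in> End_alg" for s a
    by (rule point_map_semigroup_aut[OF \<tau>' \<rho> that])
  have "polynomial_conjugation \<sigma> \<rho>"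
  proof
    fix c :: "('v \<Rightarrow> 'a) \<Rightarrow> 'v \<Rightarrow> 'a" assume "c \<in> polymap"
    then obtain s where s: "s \<in> End_alg" "point_map s = c"
      by (rule ex_End_alg_point_map)
    have "(\<lambda>x. \<sigma> (c (\<rho> x))) = point_map (\<tau> s)"
      using star[OF s(1)] s(2) \<sigma>\<rho> by (metis (no_types, lifting) ext)
    then show "(\<lambda>x. \<sigma> (c (\<rho> x))) \<in> polymap"
      by (simp add: point_map_polymap)
    have "(\<lambda>x. \<rho> (c (\<sigma> x))) = point_map (\<tau>' s)"
      using star'[OF s(1)] s(2) \<rho>\<sigma> by (metis (no_types, lifting) ext)
    then show "(\<lambda>x. \<rho> (c (\<sigma> x))) \<in> polymap"
      by (simp add: point_map_polymap)
  qed (use assms(1) \<sigma>\<rho> \<rho>\<sigma> in auto)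
  then show thesis using star by (rule that)
qed

section \<open>Coefficient maps and the semiinner form\<close>

lemma lookup_coeff_map: "\<alpha> 0 = 0 \<Longrightarrow> Poly_Mapping.lookup (coeff_map \<alpha> p) m = \<alpha> (Poly_Mapping.lookup p m)"
  by (simp add: coeff_map_def Poly_Mapping.map.rep_eq when_def)

lemma mpoly_eval_coeff_map:
  fixes p :: "('v::finite, 'a::field) mpoly"
  assumes "field_hom \<alpha>"
  shows "mpoly_eval (\<lambda>v. \<alpha> (x v)) (coeff_map \<alpha> p) = \<alpha> (mpoly_eval x p)"
proof -
  have prod: "\<alpha> (\<Prod>v\<in>A. f v) = (\<Prod>v\<in>A. \<alpha> (f v))" for A :: "'v set" and f
    by (induction A rule: infinite_finite_induct) (auto simp: field_hom_1[OF assms] field_hom_mult[OF assms])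
  have "mpoly_eval (\<lambda>v. \<alpha> (x v)) (coeff_map \<alpha> p)
      = (\<Sum>m\<in>Poly_Mapping.keys p. \<alpha> (Poly_Mapping.lookup p m) * monom_eval (\<lambda>v. \<alpha> (x v)) m)"
    unfolding mpoly_eval_def
    by (subst insertion_superset[of "Poly_Mapping.keys p"])
       (auto simp: in_keys_iff lookup_coeff_map[of \<alpha>] field_hom_0[OF assms])
  also have "\<dots> = \<alpha> (mpoly_eval x p)"
    by (simp add: mpoly_eval_def insertion_def monom_eval_def field_hom_sum[OF assms]
        field_hom_mult[OF assms] prod field_hom_power[OF assms])
  finally show ?thesis .
qed

theorem theorem3:
  fixes \<tau> :: "(('v::finite, 'a::field) mpoly \<Rightarrow> ('v, 'a) mpoly) \<Rightarrow> (('v, 'a) mpoly \<Rightarrow> ('v, 'a) mpoly)"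
  assumes "infinite (UNIV :: 'a set)"
    and "is_semigroup_aut_End \<tau>"
  shows "\<exists>\<alpha> \<eta>. is_field_aut \<alpha> \<and> is_alg_aut \<eta> \<and>
           (\<forall>s\<in>End_alg. \<tau> s = (coeff_map \<alpha> \<circ> \<eta>) \<circ> s \<circ> inv (coeff_map \<alpha> \<circ> \<eta>))"
proof -
  obtain \<sigma> \<rho> where conj: "polynomial_conjugation \<sigma> \<rho>"
    and \<tau>_point: "\<And>s a. s \<in> End_alg \<Longrightarrow> point_map (\<tau> s) (\<sigma> a) = \<sigma> (point_map s a)"
    by (rule semigroup_aut_polynomial_conjugation[OF assms]) (rule that)
  interpret polynomial_conjugation \<sigma> \<rho> by (rule conj)
  obtain \<alpha> \<beta> where \<alpha>: "field_hom \<alpha>" and \<alpha>\<beta>: "\<And>x. \<alpha> (\<beta> x) = x" and \<beta>\<alpha>: "\<And>x. \<beta> (\<alpha> x) = x"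
    and reg: "\<alpha> \<in> regular1 \<rho>" "\<beta> \<in> regular1 \<sigma>"
    by (rule field_aut_regular) (rule that)
  have \<beta>0: "\<beta> 0 = 0"
    using \<beta>\<alpha>[of 0] by (simp add: field_hom_0[OF \<alpha>])
  have "(\<lambda>x v. \<alpha> (\<rho> x v)) \<in> polymap"
    using regular1D[OF reg(1)] by (simp add: polymap_def regular_def)
  \<comment> \<open>Conjugating \<alpha> after \<rho> yields \<rho> after \<alpha>, the point map
    required of \<eta>.\<close>
  from conj_inverse[OF this] have "(\<lambda>x. \<rho> (\<lambda>v. \<alpha> (x v))) \<in> polymap"
    by (simp add: inverse_left)
  then obtain \<eta> where \<eta>: "\<eta> \<in> End_alg" "point_map \<eta> = (\<lambda>x. \<rho> (\<lambda>v. \<alpha> (x v)))"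
    by (rule ex_End_alg_point_map)
  have "(\<lambda>x v. \<beta> (\<sigma> x v)) \<in> polymap"
    using regular1D[OF reg(2)] by (simp add: polymap_def regular_def)
  then obtain \<theta> where \<theta>: "\<theta> \<in> End_alg" "point_map \<theta> = (\<lambda>x v. \<beta> (\<sigma> x v))"
    by (rule ex_End_alg_point_map)
  have "\<eta> \<circ> \<theta> = id"
    by (rule End_alg_eqI[OF assms(1) End_alg_comp[OF \<eta>(1) \<theta>(1)] id_End_alg])
       (simp only: point_map_comp[OF \<eta>(1)] \<eta>(2) \<theta>(2) point_map_id inverse_right \<beta>\<alpha>)
  moreover have "\<theta> \<circ> \<eta> = id"
    by (rule End_alg_eqI[OF assms(1) End_alg_comp[OF \<theta>(1) \<eta>(1)] id_End_alg])
       (simp only: point_map_comp[OF \<theta>(1)] \<eta>(2) \<theta>(2) point_map_id inverse_left \<alpha>\<beta>)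
  ultimately have bij_\<eta>: "bij \<eta>"
    by (intro o_bij)
  have "coeff_map \<alpha> \<circ> coeff_map \<beta> = (id :: ('v, 'a) mpoly \<Rightarrow> _)"
    "coeff_map \<beta> \<circ> coeff_map \<alpha> = (id :: ('v, 'a) mpoly \<Rightarrow> _)"
    by (auto intro!: ext poly_mapping_eqI simp: lookup_coeff_map field_hom_0[OF \<alpha>] \<beta>0 \<alpha>\<beta> \<beta>\<alpha>)
  then have "bij (coeff_map \<alpha> :: ('v, 'a) mpoly \<Rightarrow> _)"
    by (intro o_bij)
  with bij_\<eta> have bij: "bij (coeff_map \<alpha> \<circ> \<eta>)"
    by (rule bij_comp)
  have "\<tau> s = (coeff_map \<alpha> \<circ> \<eta>) \<circ> s \<circ> inv (coeff_map \<alpha> \<circ> \<eta>)" if s: "s \<in> End_alg" for s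
  proof -
    have \<tau>s: "\<tau> s \<in> End_alg"
      using assms(2) s by (auto simp: is_semigroup_aut_End_def dest: bij_betwE)
    \<comment> \<open>As an operation on functions, \<open>coeff_map \<alpha> o \<eta>\<close> sends
      \<open>p\<close> to \<open>\<alpha> o p o \<rho>\<close>: the \<alpha> inside the point map of
      \<eta> cancels against \<beta>.\<close>
    have eval: "mpoly_eval x (coeff_map \<alpha> (\<eta> p)) = \<alpha> (mpoly_eval (\<rho> x) p)" for x p
      using mpoly_eval_coeff_map[OF \<alpha>, of "\<lambda>v. \<beta> (x v)" "\<eta> p"]
      by (simp add: \<alpha>\<beta> mpoly_eval_End_alg[OF \<eta>(1)] \<eta>(2))
    have \<rho>: "\<rho> (point_map (\<tau> s) x) = point_map s (\<rho> x)" for x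
      using \<tau>_point[OF s, of "\<rho> x"] by (simp add: inverse_left inverse_right)
    \<comment> \<open>At a point \<open>x\<close> both sides take the value of \<open>p\<close> at
      \<open>point_map s (\<rho> x)\<close>, transformed by \<alpha>.\<close>
    have "\<tau> s (coeff_map \<alpha> (\<eta> p)) = coeff_map \<alpha> (\<eta> (s p))" for p
      by (rule mpoly_eqI[OF assms(1)])
         (simp only: mpoly_eval_End_alg[OF \<tau>s] eval \<rho> mpoly_eval_End_alg[OF s])
    then have "\<tau> s \<circ> (coeff_map \<alpha> \<circ> \<eta>) = (coeff_map \<alpha> \<circ> \<eta>) \<circ> s"
      by (simp add: fun_eq_iff)
    then have "(coeff_map \<alpha> \<circ> \<eta>) \<circ> s \<circ> inv (coeff_map \<alpha> \<circ> \<eta>)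
        = \<tau> s \<circ> ((coeff_map \<alpha> \<circ> \<eta>) \<circ> inv (coeff_map \<alpha> \<circ> \<eta>))"
      by (metis comp_assoc)
    also have "\<dots> = \<tau> s"
      using bij by (simp only: bij_is_surj surj_iff[THEN iffD1] comp_id)
    finally show ?thesis by simp
  qed
  moreover have "is_field_aut \<alpha>"
    using \<alpha> \<alpha>\<beta> \<beta>\<alpha> by (auto simp: is_field_aut_def field_hom_def intro!: o_bij[of \<beta>])
  moreover have "is_alg_aut \<eta>"
    using \<eta>(1) bij_\<eta> by (simp add: is_alg_aut_def End_alg_def)
  ultimately show ?thesis by blast
qed

end
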